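(* Let $0<C<1/(4e^2)$ and $r_1>1$. Choose $k_0\in\mathbb{N}$ such that $2^{k_0-1}C>2r_1$, choose $r_2,\dots,r_{k_0}$ such that $r_{k+1}\geq 2r_k$ for $1\leq k<k_0$, and put $$r_{k+1}=C^2\prod_{j=1}^{k}\left(1+\frac{r_k}{r_j}\right)^2$$ for $k\geq k_0$. Let $$f(z)=C^2\prod_{k=1}^\infty\left(1+\frac{z}{r_k}\right)^2.$$ For large $k$ let $U_k$ be the multiply connected (in fact infinitely connected) wandering domain of $f$ which contains the annulus $\left\{z\in\mathbb{C}: r_k^2<|z|<\frac{k+1}{k+2}r_{k+1}\right\}$. Then $\partial U_k$ is not uniformly perfect.
   Context: The Fatou set of an entire function $f$ is the set of points of $\mathbb{C}$ near which the iterates $f^n$ form a normal family; Fatou components are its connected components. A Fatou component $U$ is a wandering domain if the Fatou components containing $f^j(U)$, $j\ge 0$, are pairwise different. It is known (Baker) that in the setting of the claim, with $B_k=\{z: r_k^2<|z|<\frac{k+1}{k+2}r_{k+1}\}$, one has $f(B_k)\subset B_{k+1}$ for large $k$, and $B_k$ is contained in an infinitely connected Fatou component $U_k$ which is a wandering domain. A domain $U\subset\mathbb{C}$ is infinitely connected if $\widehat{\mathbb{C}}\setminus U$ has infinitely many connected components. A closed set $K\subset\mathbb{C}$ is uniformly perfect if there exists $c>0$ such that for all $a\in K$ and $0<r<\operatorname{diam}(K)$ one has $\{z\in\mathbb{C}: cr<|z-a|<r\}\cap K\neq\emptyset$. *)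

theory Defs
  imports "HOL-Complex_Analysis.Complex_Analysis" "HOL-Library.Extended_Real"
begin

(* Normality with respect to the spherical metric: the constant limit infinity is
   allowed. On a connected set S these are the only two kinds of limits of a locally
   uniformly convergent sequence of holomorphic functions; the Fatou set below uses
   this notion on balls only. *)
definition normal_family :: "(complex \<Rightarrow> complex) set \<Rightarrow> complex set \<Rightarrow> bool" where
  "normal_family F S \<longleftrightarrow>
     (\<forall>g :: nat \<Rightarrow> complex \<Rightarrow> complex. range g \<subseteq> F \<longrightarrow>
       (\<exists>s :: nat \<Rightarrow> nat. strict_mono s \<and>
         ((\<exists>h. \<forall>K. compact K \<and> K \<subseteq> S \<longrightarrow>
              uniform_limit K (\<lambda>n. g (s n)) h sequentially) \<or>
          (\<forall>K. compact K \<and> K \<subseteq> S \<longrightarrow>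
              (\<forall>M::real. \<forall>\<^sub>F n in sequentially. \<forall>z\<in>K. M < norm (g (s n) z))))))"

definition fatou_set :: "(complex \<Rightarrow> complex) \<Rightarrow> complex set" where
  "fatou_set f = {z. \<exists>e>0. normal_family (range (\<lambda>n. f ^^ n)) (ball z e)}"

definition fatou_component :: "(complex \<Rightarrow> complex) \<Rightarrow> complex set \<Rightarrow> bool" where
  "fatou_component f U \<longleftrightarrow> U \<in> components (fatou_set f)"

definition wandering_domain :: "(complex \<Rightarrow> complex) \<Rightarrow> complex set \<Rightarrow> bool" where
  "wandering_domain f U \<longleftrightarrow>
     fatou_component f U \<and>
     (\<exists>V :: nat \<Rightarrow> complex set.
        (\<forall>j. fatou_component f (V j) \<and> (f ^^ j) ` U \<subseteq> V j) \<and> inj V)"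

definition multiply_connected :: "complex set \<Rightarrow> bool" where
  "multiply_connected U \<longleftrightarrow> open U \<and> connected U \<and> \<not> simply_connected U"

(* The library's real-valued diameter is meaningless for unbounded sets, whose
   diameter should be infinite. *)
definition ediameter :: "complex set \<Rightarrow> ereal" where
  "ediameter K = (SUP x\<in>K. SUP y\<in>K. ereal (dist x y))"

definition uniformly_perfect :: "complex set \<Rightarrow> bool" where
  "uniformly_perfect K \<longleftrightarrow>
     closed K \<and>
     (\<exists>c>0. \<forall>a\<in>K. \<forall>r::real. 0 < r \<and> ereal r < ediameter K \<longrightarrow>
        {z. c * r < cmod (z - a) \<and> cmod (z - a) < r} \<inter> K \<noteq> {})"

end

theory Submission
  imports Defs "HOL-Real_Asymp.Real_Asymp"
begin

text \<open>
  A ring of large modulus that lies in \<open>U\<close> and encloses a point outside \<open>U\<close> refutes a given constant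
  of uniform perfectness, so it suffices to find such rings with moduli tending to infinity.  Every
  zero \<open>- r n\<close> is double and \<open>f\<close> is huge outside a tiny disc around it, so \<open>f\<close> maps a ring around
  \<open>- r n\<close> whose radii have ratio \<open>16 ^ n / (4 * n)\<close> into the next annulus of the escaping chain; hence
  the ring lies in the Fatou set, where it is joined to the annulus below \<open>r n\<close>.  In the coordinate \<open>u\<close>
  with \<open>z = r j * exp u\<close>, \<open>f\<close> is a perturbation of the linear map \<open>u \<mapsto> 2 * (j - 1) * u\<close> with bounded
  derivative, so it has an inverse branch on \<open>cball 0 5\<close>, a disc that contains the point \<open>\<i> * pi\<close>
  corresponding to the zero, and this branch loses at most a factor \<open>4\<close> in the ratio of the radii.
  Pulling the ring back from level \<open>n\<close> to the fixed level \<open>k + 1\<close> therefore leaves rings in \<open>U\<close> whose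
  moduli are unbounded.  Their centres are iterated preimages of \<open>0\<close>, and \<open>0\<close> lies in at most one
  component of the wandering orbit of \<open>U\<close>.
\<close>

section \<open>Separating rings and uniform perfectness\<close>

text \<open>A segment from \<open>a0\<close> into the ring meets the frontier at a point
  \<open>a\<close> within \<alpha> of \<open>a0\<close>, and a segment towards \<open>y\<close>
  meets it far away, so the diameter exceeds \<open>\<beta> / 2\<close>. Within distance
  \<open>\<beta> / 2\<close> of \<open>a\<close>, frontier points are confined to distance at most
  \<open>2 * \<alpha>\<close>.\<close>

lemma not_uniformly_perfect_frontierI:
  fixes U :: "complex set"
  assumes "open U"
    and annuli: "\<And>\<epsilon>. \<epsilon> > 0 \<Longrightarrow> \<exists>a0 \<alpha> \<beta> y. 0 < \<alpha> \<and> \<alpha> < \<epsilon> * \<beta> \<and>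
           {z. \<alpha> < dist z a0 \<and> dist z a0 < \<beta>} \<subseteq> U \<and> a0 \<notin> U \<and> y \<notin> U \<and> \<beta> \<le> dist y a0"
  shows "\<not> uniformly_perfect (frontier U)"
proof
  assume "uniformly_perfect (frontier U)"
  then obtain c where "c > 0" and c: "\<And>a r. a \<in> frontier U \<Longrightarrow> 0 < r \<Longrightarrow> ereal r < ediameter (frontier U)
      \<Longrightarrow> {z. c * r < cmod (z - a) \<and> cmod (z - a) < r} \<inter> frontier U \<noteq> {}"
    unfolding uniformly_perfect_def by metis
  \<comment> \<open>With \<open>c / 4\<close>, points within \<open>2 * \<alpha>\<close> of
    \<open>a\<close> are too close for the test ring of inner radius \<open>c * \<beta> / 2\<close>;
    with \<open>1 / 8\<close>, the test ring stays within \<beta> of \<open>a0\<close>.\<close>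
  from \<open>c > 0\<close> have "min (c / 4) (1 / 8) > 0" by simp
  from annuli[OF this] obtain a0 \<alpha> \<beta> y where "0 < \<alpha>" and ab: "\<alpha> < min (c / 4) (1 / 8) * \<beta>"
    and sub: "{z. \<alpha> < dist z a0 \<and> dist z a0 < \<beta>} \<subseteq> U" and "a0 \<notin> U" "y \<notin> U" "\<beta> \<le> dist y a0"
    by blast
  have "\<beta> > 0"
    using ab \<open>0 < \<alpha>\<close> \<open>c > 0\<close>
    by (metis \<open>0 < min (c / 4) (1 / 8)\<close> dual_order.strict_trans zero_less_mult_pos)
  have "min (c / 4) (1 / 8) * \<beta> \<le> (c / 4) * \<beta>" "min (c / 4) (1 / 8) * \<beta> \<le> (1 / 8) * \<beta>"
    using \<open>\<beta> > 0\<close> by (intro mult_right_mono; simp)+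
  with ab have ac: "\<alpha> < c * \<beta> / 4" and a8: "\<alpha> < \<beta> / 8" by linarith+
  have free: "dist z a0 \<le> \<alpha> \<or> \<beta> \<le> dist z a0" if "z \<in> frontier U" for z
  proof -
    have "z \<notin> U" using that \<open>open U\<close> by (simp add: frontier_def interior_open)
    thus ?thesis using sub not_le by blast
  qed
  \<comment> \<open>A radius strictly inside the ring. A frontier point within
    \<open>\<gamma>\<close> of \<open>a0\<close> is already within \<alpha>, and one at distance at
    least \<open>\<gamma>\<close> is more than \<open>\<beta> / 2\<close> away from it, since
    \<open>3/4 - 1/8 > 1/2\<close>.\<close>
  define \<gamma> where "\<gamma> = 3 * \<beta> / 4"
  have \<gamma>: "0 < \<gamma>" "\<alpha> < \<gamma>" "\<gamma> < \<beta>" using a8 \<open>\<beta> > 0\<close> \<open>\<alpha> > 0\<close> by (auto simp: \<gamma>_def)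
  define p where "p = a0 + complex_of_real \<gamma>"
  have "p \<in> U" using sub \<gamma> by (auto simp: p_def dist_norm)
  have "closed_segment a0 p \<inter> frontier U \<noteq> {}"
    using connected_Int_frontier[of "closed_segment a0 p" U] \<open>p \<in> U\<close> \<open>a0 \<notin> U\<close> by auto
  then obtain a where a: "a \<in> closed_segment a0 p" "a \<in> frontier U" by auto
  have "dist a a0 \<le> dist p a0"
    using segment_bound1[OF a(1)] by (simp add: dist_norm)
  also have "dist p a0 = \<gamma>" using \<gamma> by (simp add: p_def dist_norm)
  finally have a_near: "dist a a0 \<le> \<alpha>" using free[OF a(2)] \<gamma> by auto
  define d where "d = dist y a0"
  have d: "d \<ge> \<beta>" "d > 0" using \<open>\<beta> \<le> dist y a0\<close> \<open>\<beta> > 0\<close> by (auto simp: d_def)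
  \<comment> \<open>The point at distance \<open>\<gamma>\<close> from \<open>a0\<close> in the
    direction of \<open>y\<close>, so that the whole segment from \<open>q\<close> to
    \<open>y\<close> keeps at least this distance.\<close>
  define q where "q = a0 + complex_of_real (\<gamma> / d) * (y - a0)"
  have "dist q a0 = \<gamma>" using d \<gamma> by (simp add: q_def dist_norm norm_mult norm_divide d_def)
  hence "q \<in> U" using sub \<gamma> by auto
  have "closed_segment q y \<inter> frontier U \<noteq> {}"
    using connected_Int_frontier[of "closed_segment q y" U] \<open>q \<in> U\<close> \<open>y \<notin> U\<close> by auto
  then obtain b where b: "b \<in> closed_segment q y" "b \<in> frontier U" by auto
  then obtain t where t: "0 \<le> t" "t \<le> 1" and bt: "b = (1 - t) *\<^sub>R q + t *\<^sub>R y"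
    by (auto simp: in_segment)
  have "b - a0 = complex_of_real ((1 - t) * (\<gamma> / d) + t) * (y - a0)"
    by (simp add: bt q_def scaleR_conv_of_real algebra_simps)
  hence "dist b a0 = \<bar>(1 - t) * (\<gamma> / d) + t\<bar> * d" by (simp only: dist_norm norm_mult norm_of_real d_def)
  also have "\<dots> = (1 - t) * \<gamma> + t * d"
  proof (subst abs_of_nonneg)
    show "0 \<le> (1 - t) * (\<gamma> / d) + t" using t d \<gamma> by (intro add_nonneg_nonneg mult_nonneg_nonneg) auto
  qed (use d in \<open>simp add: field_simps\<close>)
  also have "\<dots> \<ge> (1 - t) * \<gamma> + t * \<gamma>" using t d \<gamma> by (intro add_left_mono mult_left_mono) auto
  finally have "\<gamma> \<le> dist b a0" by (simp add: algebra_simps)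
  hence dab: "\<beta> / 2 < dist a b" using a_near a8 dist_triangle2[of b a0 a] dist_commute[of a b] dist_commute[of a a0]
    using \<open>\<beta> > 0\<close> by (simp add: \<gamma>_def)
  have "ereal (\<beta> / 2) < ereal (dist a b)" using dab by simp
  also have "\<dots> \<le> ediameter (frontier U)"
    unfolding ediameter_def by (intro SUP_upper2[OF a(2)] SUP_upper2[OF b(2)]) simp
  finally obtain z where z: "c * (\<beta> / 2) < cmod (z - a)" "cmod (z - a) < \<beta> / 2" "z \<in> frontier U"
    using c[OF a(2), of "\<beta> / 2"] \<open>\<beta> > 0\<close> by auto
  have "dist z a0 \<le> cmod (z - a) + dist a a0" "cmod (z - a) \<le> dist z a0 + dist a a0"
    using dist_triangle[of z a0 a] dist_triangle[of z a a0] by (simp_all add: dist_norm norm_minus_commute)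
  thus False using free[OF z(3)] z a_near ac a8 by linarith
qed

section \<open>Escaping chains and the Fatou set\<close>

text \<open>By continuity a whole ball around \<open>z\<close> enters \<open>A j\<close> after
  \<open>m\<close> steps and then follows the chain, so the bounds \<open>R\<close> drive the
  iterates to infinity uniformly on this ball.\<close>

lemma fatou_set_if_escaping:
  fixes f :: "complex \<Rightarrow> complex" and A :: "nat \<Rightarrow> complex set" and R :: "nat \<Rightarrow> real"
  assumes cont: "continuous_on UNIV f" and op: "\<And>j. open (A j)"
    and inv: "\<And>j. j \<ge> J \<Longrightarrow> f ` A j \<subseteq> A (Suc j)"
    and large: "\<And>j z. z \<in> A j \<Longrightarrow> R j < norm z"
    and R: "filterlim R at_top sequentially"
    and z: "(f ^^ m) z \<in> A j" "j \<ge> J"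
  shows "z \<in> fatou_set f"
proof -
  have contm: "continuous_on UNIV (f ^^ m)"
    by (induction m) (auto intro!: continuous_intros continuous_on_compose2[OF cont] simp: o_def)
  have "open ((f ^^ m) -` A j)"
    using open_vimage[OF op contm] by simp
  then obtain e where e: "e > 0" "ball z e \<subseteq> (f ^^ m) -` A j"
    using z(1) by (meson open_contains_ball vimageI)
  have orb: "(f ^^ (m + i)) w \<in> A (j + i)" if "w \<in> ball z e" for w i
  proof (induction i)
    case 0
    then show ?case using that e by auto
  next
    case (Suc i)
    have "f ((f ^^ (m + i)) w) \<in> A (Suc (j + i))"
      using inv[of "j + i"] Suc z(2) by auto
    thus ?case by simp
  qed
  have "normal_family (range (\<lambda>n. f ^^ n)) (ball z e)"
    unfolding normal_family_def
  proof (intro allI impI)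
    fix g :: "nat \<Rightarrow> complex \<Rightarrow> complex"
    assume "range g \<subseteq> range (\<lambda>n. f ^^ n)"
    hence "\<forall>n. \<exists>p. g n = f ^^ p" by auto
    then obtain p where p: "\<And>n. g n = f ^^ p n" by metis
    show "\<exists>s :: nat \<Rightarrow> nat. strict_mono s \<and>
         ((\<exists>h. \<forall>K. compact K \<and> K \<subseteq> ball z e \<longrightarrow> uniform_limit K (\<lambda>n. g (s n)) h sequentially) \<or>
          (\<forall>K. compact K \<and> K \<subseteq> ball z e \<longrightarrow>
              (\<forall>M::real. \<forall>\<^sub>F n in sequentially. \<forall>z\<in>K. M < norm (g (s n) z))))"
    \<comment> \<open>Either one iterate recurs infinitely often and gives a constant subsequence,
      or every index occurs finitely often; then the indices tend to infinity and the full sequence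
      diverges.\<close>
    proof (cases "\<exists>i. infinite {n. p n = i}")
      case True
      then obtain i where i: "infinite {n. p n = i}" by auto
      define s where "s = enumerate {n. p n = i}"
      have "strict_mono s" unfolding s_def using i by (rule strict_mono_enumerate)
      moreover have "g (s n) = f ^^ i" for n
        using enumerate_in_set[OF i, of n] by (simp add: p s_def)
      hence "uniform_limit K (\<lambda>n. g (s n)) (f ^^ i) sequentially" for K
        by (simp add: uniform_limit_const)
      ultimately show ?thesis by blast
    next
      case False
      have "\<forall>\<^sub>F n in sequentially. \<forall>w\<in>ball z e. M < norm (g n w)" for M
      proof -
        from R have "\<forall>\<^sub>F i in sequentially. M < R i" by (simp add: filterlim_at_top_dense)
        then obtain N where N: "\<And>i. i \<ge> N \<Longrightarrow> M < R i" by (auto simp: eventually_sequentially)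
        have "{n. p n < m + N} = (\<Union>i<m + N. {n. p n = i})" by auto
        hence "finite {n. p n < m + N}" using False by simp
        hence "\<forall>\<^sub>F n in sequentially. \<not> p n < m + N"
          by (simp add: eventually_cofinite flip: cofinite_eq_sequentially)
        thus ?thesis
        proof eventually_elim
          case (elim n)
          show ?case
          proof
            fix w assume w: "w \<in> ball z e"
            have "M < R (j + (p n - m))" using elim by (intro N) linarith
            also have "\<dots> < norm ((f ^^ (m + (p n - m))) w)" by (intro large orb w)
            finally show "M < norm (g n w)" using elim by (simp add: p)
          qed
        qed
      qed
      then have "\<forall>\<^sub>F n in sequentially. \<forall>w\<in>K. M < norm (g (id n) w)" if "K \<subseteq> ball z e" for K M
        using \<open>\<forall>\<^sub>F n in sequentially. \<forall>w\<in>ball z e. M < norm (g n w)\<close> by eventually_elim (use that in auto)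
      thus ?thesis using strict_mono_id by blast
    qed
  qed
  thus ?thesis using e(1) unfolding fatou_set_def by blast
qed

section \<open>Inverting perturbations of a linear map\<close>

text \<open>The linear term dominates because \<open>40 \<le> c / 2\<close>. The quotient 4 of the
  two constants is the loss in the ratio of the radii at each pullback.\<close>

lemma perturbed_linear_bilipschitz:
  fixes K :: "complex \<Rightarrow> complex" and c :: real
  assumes c: "c \<ge> 100"
    and lip: "\<And>u v. u \<in> cball 0 (1/2) \<Longrightarrow> v \<in> cball 0 (1/2) \<Longrightarrow> dist (K u) (K v) \<le> 40 * dist u v"
    and uv: "u \<in> cball 0 (1/2)" "v \<in> cball 0 (1/2)"
  shows "c / 2 * dist u v \<le> dist (of_real c * u + K u) (of_real c * v + K v)"
    and "dist (of_real c * u + K u) (of_real c * v + K v) \<le> 2 * c * dist u v"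
proof -
  have eq: "(of_real c * u + K u) - (of_real c * v + K v) = of_real c * (u - v) + (K u - K v)"
    by (simp add: algebra_simps)
  have cd: "cmod (of_real c * (u - v)) = c * dist u v" using c by (simp add: norm_mult dist_norm)
  have "dist (K u) (K v) \<le> 40 * dist u v" by (rule lip[OF uv])
  also have "\<dots> \<le> c / 2 * dist u v" using c by (intro mult_right_mono) auto
  finally have l: "cmod (K u - K v) \<le> c / 2 * dist u v" by (simp add: dist_norm)
  have "c / 2 * dist u v + c / 2 * dist u v = c * dist u v" by simp
  then show "c / 2 * dist u v \<le> dist (of_real c * u + K u) (of_real c * v + K v)"
    using norm_diff_ineq[of "of_real c * (u - v)" "K u - K v"] l cd unfolding dist_norm[of "of_real c * u + K u"] eq
    by linarith
  have "c / 2 * dist u v \<le> c * dist u v" using c by (intro mult_right_mono) auto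
  then show "dist (of_real c * u + K u) (of_real c * v + K v) \<le> 2 * c * dist u v"
    using norm_triangle_ineq[of "of_real c * (u - v)" "K u - K v"] l cd unfolding dist_norm[of "of_real c * u + K u"] eq
    by linarith
qed

text \<open>A solution is a fixed point of \<open>u \<mapsto> (w - K u) / c\<close>, which maps
  \<open>cball 0 (1/2)\<close> into itself because \<open>(5 + 12) / 100 \<le> 1/2\<close> and
  contracts by \<open>40 / 100\<close>. Uniqueness and continuity follow from the lower Lipschitz
  bound.\<close>

lemma perturbed_linear_inverse:
  fixes K :: "complex \<Rightarrow> complex" and c :: real
  assumes c: "c \<ge> 100"
    and bd: "\<And>u. u \<in> cball 0 (1/2) \<Longrightarrow> norm (K u) \<le> 12"
    and lip: "\<And>u v. u \<in> cball 0 (1/2) \<Longrightarrow> v \<in> cball 0 (1/2) \<Longrightarrow> dist (K u) (K v) \<le> 40 * dist u v"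
  obtains G where "\<And>w. w \<in> cball 0 5 \<Longrightarrow> norm (G w) \<le> 17 / c"
    and "\<And>w. w \<in> cball 0 5 \<Longrightarrow> of_real c * G w + K (G w) = w"
    and "\<And>u w. u \<in> cball 0 (1/2) \<Longrightarrow> of_real c * u + K u = w \<Longrightarrow> w \<in> cball 0 5 \<Longrightarrow> G w = u"
    and "continuous_on (cball 0 5) G"
proof -
  have ex: "\<exists>u. u \<in> cball 0 (1/2) \<and> of_real c * u + K u = w" if w: "w \<in> cball 0 5" for w
  proof -
    have "\<exists>!u\<in>cball 0 (1/2). (w - K u) / of_real c = u"
    proof (rule Banach_fix)
      show "(\<lambda>u. (w - K u) / of_real c) ` cball 0 (1/2) \<subseteq> cball 0 (1/2)"
      proof safe
        fix u :: complex assume u: "u \<in> cball 0 (1/2)"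
        have "norm (w - K u) \<le> 5 + 12"
          using norm_triangle_ineq4[of w "K u"] bd[OF u] w by simp
        thus "(w - K u) / of_real c \<in> cball 0 (1/2)"
          using c by (simp add: norm_divide field_simps)
      qed
      show "dist ((w - K u) / of_real c) ((w - K v) / of_real c) \<le> 2/5 * dist u v"
        if "u \<in> cball 0 (1/2)" "v \<in> cball 0 (1/2)" for u v
      proof -
        have "dist ((w - K u) / of_real c) ((w - K v) / of_real c) = norm ((K v - K u) / of_real c)"
          by (simp add: dist_norm diff_divide_distrib)
        also have "\<dots> = dist (K u) (K v) / c" using c by (simp add: norm_divide dist_norm norm_minus_commute)
        also have "\<dots> \<le> 40 * dist u v / c" using c lip[OF that] by (intro divide_right_mono) auto
        also have "\<dots> \<le> 40 * dist u v / 100" using c by (intro divide_left_mono) auto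
        finally show ?thesis by simp
      qed
    qed (auto simp: complete_eq_closed)
    then obtain u where u: "u \<in> cball 0 (1/2)" "(w - K u) / of_real c = u" by blast
    hence "of_real c * u + K u = w" using c by (auto simp: field_simps)
    with u show ?thesis by blast
  qed
  define G where "G w = (SOME u. u \<in> cball 0 (1/2) \<and> of_real c * u + K u = w)" for w
  have G: "G w \<in> cball 0 (1/2)" "of_real c * G w + K (G w) = w" if "w \<in> cball 0 5" for w
    using someI_ex[OF ex[OF that]] by (auto simp: G_def)
  note bil = perturbed_linear_bilipschitz[OF c lip]
  have contr: "dist (G w) (G w') \<le> 1 * dist w w'" if "w \<in> cball 0 5" "w' \<in> cball 0 5" for w w'
  proof -
    have "1 * dist (G w) (G w') \<le> c / 2 * dist (G w) (G w')"
      using c by (intro mult_right_mono) auto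
    also have "\<dots> \<le> dist w w'"
      using bil(1)[OF _ _ G(1)[OF that(1)] G(1)[OF that(2)]] unfolding G(2)[OF that(1)] G(2)[OF that(2)] .
    finally show ?thesis by simp
  qed
  show ?thesis
  proof (rule that[of G])
    fix w :: complex assume w: "w \<in> cball 0 5"
    have "of_real c * G w = w - K (G w)" using G(2)[OF w] by (simp add: algebra_simps)
    hence "c * norm (G w) = norm (w - K (G w))" using c by (metis abs_of_nonneg dual_order.trans norm_mult norm_of_real zero_le_numeral)
    also have "\<dots> \<le> 17" using norm_triangle_ineq4[of w "K (G w)"] bd[OF G(1)[OF w]] w by simp
    finally show "norm (G w) \<le> 17 / c" using c by (simp add: field_simps)
    show "of_real c * G w + K (G w) = w" by (rule G(2)[OF w])
  next
    fix u w :: complex assume u: "u \<in> cball 0 (1/2)" "of_real c * u + K u = w" and w: "w \<in> cball 0 5"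
    have "c / 2 * dist (G w) u \<le> 0"
      using bil(1)[OF _ _ G(1)[OF w] u(1)] unfolding G(2)[OF w] u(2) by simp
    thus "G w = u" using c by (simp add: mult_le_0_iff)
  next
    show "continuous_on (cball 0 5) G"
      by (rule lipschitz_on_continuous_on[of 1]) (use contr in \<open>auto simp: lipschitz_on_def\<close>)
  qed
qed

section \<open>Growth of the zeros\<close>

text \<open>The factorisation \<open>P ^ 2 - 1 = (P - 1) * (P + 1)\<close> gives at most
  \<open>2/1000 * 3\<close>. The square appears because all zeros of \<open>f\<close> are
  double.\<close>

lemma norm_prod_squared_minus_1_le:
  fixes a :: "nat \<Rightarrow> complex"
  assumes "(\<Sum>i\<in>A. norm (a i)) \<le> 1/1000"
  shows "norm ((\<Prod>i\<in>A. 1 + a i)\<^sup>2 - 1) \<le> 1/100"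
proof -
  define P where "P = (\<Prod>i\<in>A. 1 + a i)"
  have "norm (P - 1) \<le> (\<Prod>i\<in>A. 1 + norm (a i)) - 1"
    unfolding P_def by (rule norm_prod_minus1_le_prod_minus1)
  also have "(\<Prod>i\<in>A. 1 + norm (a i)) \<le> exp (\<Sum>i\<in>A. norm (a i))" by (rule prod_le_exp_sum) auto
  also have "\<dots> \<le> exp (1/1000)" using assms by simp
  also have "\<dots> \<le> 1 + 2 * (1/1000)" by (rule real_exp_bound_lemma) auto
  finally have d: "norm (P - 1) \<le> 2/1000" by simp
  have "norm (P + 1) \<le> norm (P - 1) + norm (2::complex)"
    using norm_triangle_ineq[of "P - 1" 2] by (simp add: add.commute)
  hence "norm (P + 1) \<le> 3" using d by simp
  hence "norm (P - 1) * norm (P + 1) \<le> 2/1000 * 3" using d by (intro mult_mono) auto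
  thus ?thesis by (simp add: P_def[symmetric] power2_eq_square algebra_simps flip: norm_mult)
qed

locale baker_product =
  fixes C :: real and r :: "nat \<Rightarrow> real" and k0 :: nat and f :: "complex \<Rightarrow> complex"
  assumes C_pos: "0 < C"
    and r1: "r 1 > 1"
    and k0: "2 ^ (k0 - 1) * C > 2 * r 1"
    and r_initial: "\<And>k. 1 \<le> k \<Longrightarrow> k < k0 \<Longrightarrow> r (k + 1) \<ge> 2 * r k"
    and r_rec: "\<And>k. k \<ge> k0 \<Longrightarrow> r (k + 1) = C\<^sup>2 * (\<Prod>j = 1..k. (1 + r k / r j)\<^sup>2)"
    and f_eq: "\<And>z. f z = (complex_of_real C)\<^sup>2 * (\<Prod>k. (1 + z / complex_of_real (r (k + 1)))\<^sup>2)"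
begin

text \<open>The three claims need a common induction: doubling below \<open>k\<close> bounds the
  factors of the recursion from below, this gives the quadratic bound, and by the choice of
  \<open>k0\<close> the quadratic bound gives doubling at \<open>k\<close>.\<close>

lemma r_growth: "k \<ge> 1 \<Longrightarrow> r (Suc k) \<ge> 2 * r k \<and> r k > 1 \<and>
    (k \<ge> k0 \<longrightarrow> r (Suc k) \<ge> (2 ^ (k - 1) * C / r 1 * r k)\<^sup>2)"
proof (induction k rule: less_induct)
  case (less k)
  have double: "2 * r i \<le> r (Suc i)" if "1 \<le> i" "i < k" for i using less.IH that by auto
  have gt1: "r k > 1"
  proof (cases "k = 1")
    case False
    then obtain i where i: "k = Suc i" "1 \<le> i" using less.prems by (cases k) auto
    show ?thesis using less.IH[of i] i by auto
  qed (use r1 in auto)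
  have le: "1 < r i \<and> 2 ^ (k - i) * r i \<le> r k" if "1 \<le> i" "i \<le> k" for i
    using that(2,1)
  proof (induction rule: inc_induct)
    case base
    then show ?case using gt1 by simp
  next
    case (step i)
    have "2 ^ (k - i) * r i = 2 ^ (k - Suc i) * (2 * r i)"
      using step.hyps by (simp add: Suc_diff_Suc[symmetric])
    also have "\<dots> \<le> 2 ^ (k - Suc i) * r (Suc i)" using double step by (intro mult_left_mono) auto
    also have "\<dots> \<le> r k" using step by auto
    finally show ?case using less.IH[of i] step by auto
  qed
  have key: "r (Suc k) \<ge> (2 ^ (k - 1) * C / r 1 * r k)\<^sup>2" if "k \<ge> k0"
  proof -
    have sq: "4 ^ (k - Suc 0) = ((2::real) ^ (k - Suc 0))\<^sup>2"
      using power_mult_distrib[of "2::real" 2 "k - Suc 0"] by (simp add: power2_eq_square)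
    have "{1..k} = insert 1 {2..k}" using less.prems by auto
    hence "(\<Prod>j = 1..k. (1 + r k / r j)\<^sup>2) = (1 + r k / r 1)\<^sup>2 * (\<Prod>j = 2..k. (1 + r k / r j)\<^sup>2)"
      by simp
    \<comment> \<open>The factor of index 1 keeps its full size up to the summand 1; each other
      factor is only used to contribute a 2.\<close>
    also have "\<dots> \<ge> (r k / r 1)\<^sup>2 * (\<Prod>j = 2..k. 2\<^sup>2)"
    proof (intro mult_mono prod_mono power_mono conjI)
      fix j assume j: "j \<in> {2..k}"
      have "1 * r j \<le> 2 ^ (k - j) * r j" using le[of j] j by (intro mult_right_mono) auto
      moreover have "2 ^ (k - j) * r j \<le> r k" "r j > 1" using le[of j] j by auto
      ultimately have "r j \<le> r k" "r j > 1" by linarith+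
      thus "2 \<le> 1 + r k / r j" by simp
    qed (use gt1 r1 in \<open>auto intro!: prod_nonneg\<close>)


    finally have "C\<^sup>2 * ((r k / r 1)\<^sup>2 * (2\<^sup>2) ^ (k - 1)) \<le> C\<^sup>2 * (\<Prod>j = 1..k. (1 + r k / r j)\<^sup>2)"
      by (intro mult_left_mono) auto
    also have "\<dots> = r (Suc k)" using r_rec[OF that] by simp
    also have "C\<^sup>2 * ((r k / r 1)\<^sup>2 * (2\<^sup>2) ^ (k - 1)) = (2 ^ (k - 1) * C / r 1 * r k)\<^sup>2"
      by (simp add: power_mult_distrib power_divide sq)
    finally show ?thesis .
  qed
  have "2 * r k \<le> r (Suc k)"
  proof (cases "k < k0")
    case True
    then show ?thesis using r_initial[of k] less.prems by simp
  next
    case False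
    have "2 * r 1 \<le> 2 ^ (k0 - 1) * C" using k0 by simp
    also have "\<dots> \<le> 2 ^ (k - 1) * C" using False C_pos by (intro mult_right_mono power_increasing) auto
    finally have "2 \<le> 2 ^ (k - 1) * C / r 1" using r1 by (simp add: field_simps)
    hence "2 * r k \<le> 2 ^ (k - 1) * C / r 1 * r k" using gt1 by (intro mult_right_mono) auto
    hence "(2 * r k)\<^sup>2 \<le> (2 ^ (k - 1) * C / r 1 * r k)\<^sup>2" using gt1 by (intro power_mono) auto
    also have "\<dots> \<le> r (Suc k)" using key False by simp
    finally have "4 * (r k * r k) \<le> r (Suc k)" by (simp add: power2_eq_square)
    moreover have "1 * r k \<le> r k * r k" using gt1 by (intro mult_right_mono) auto
    ultimately show ?thesis using gt1 by linarith
  qed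
  thus ?case using gt1 key by auto
qed

lemma r_gt_1: "k \<ge> 1 \<Longrightarrow> r k > 1" and r_double: "k \<ge> 1 \<Longrightarrow> 2 * r k \<le> r (Suc k)"
  using r_growth by auto

lemma r_pos: "k \<ge> 1 \<Longrightarrow> r k > 0" using r_gt_1[of k] by simp

lemma r_mono: "1 \<le> i \<Longrightarrow> i \<le> k \<Longrightarrow> r i \<le> r k"
proof (induction k)
  case (Suc k)
  show ?case
  proof (cases "i = Suc k")
    case False
    with Suc have "r i \<le> r k" "k \<ge> 1" by auto
    with r_double[of k] r_pos[of k] show ?thesis by linarith
  qed simp
qed simp

lemma r_ge_power: "k \<ge> 1 \<Longrightarrow> r k \<ge> 2 ^ (k - 1)"
proof (induction k rule: dec_induct)
  case base
  then show ?case using r1 by simp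
next
  case (step k)
  have "2 ^ (Suc k - 1) = (2::real) * 2 ^ (k - 1)" using step.hyps by (cases k) auto
  also have "\<dots> \<le> r (Suc k)" using step r_double[of k] by linarith
  finally show ?case .
qed

lemma filterlim_r: "filterlim r at_top sequentially"
proof (rule filterlim_at_top_mono)
  show "filterlim (\<lambda>k. 2 ^ (k - 1) :: real) at_top sequentially" by real_asymp
  show "\<forall>\<^sub>F k in sequentially. 2 ^ (k - 1) \<le> r k"
    using eventually_ge_at_top[of 1] by eventually_elim (rule r_ge_power)
qed

text \<open>The factor \<open>2 ^ (k - 1) * C / r 1\<close> in \<open>r_growth\<close> is unbounded
  in \<open>k\<close>.\<close>

lemma eventually_r_square:
  "\<forall>\<^sub>F k in sequentially. M * (r k)\<^sup>2 \<le> r (Suc k)"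
proof -
  have "\<forall>\<^sub>F k in sequentially. (2 ^ (k - 1) * C / r 1)\<^sup>2 \<ge> M"
  proof -
    have "filterlim (\<lambda>k. (2 ^ (k - 1) * C / r 1)\<^sup>2) at_top sequentially"
      using C_pos r1 by real_asymp
    thus ?thesis by (simp add: filterlim_at_top)
  qed
  thus ?thesis using eventually_ge_at_top[of k0] eventually_ge_at_top[of 1]
  proof eventually_elim
    case (elim k)
    have "M * (r k)\<^sup>2 \<le> (2 ^ (k - 1) * C / r 1)\<^sup>2 * (r k)\<^sup>2" using elim by (intro mult_right_mono) auto
    also have "\<dots> = (2 ^ (k - 1) * C / r 1 * r k)\<^sup>2" by (rule power_mult_distrib[symmetric])
    also have "\<dots> \<le> r (Suc k)" using r_growth[of k] elim by blast
    finally show ?case .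
  qed
qed

lemma eventually_r_Suc: "\<forall>\<^sub>F k in sequentially. M * r k \<le> r (Suc k)"
  using eventually_r_square[of "max M 0"] eventually_ge_at_top[of 1]
proof eventually_elim
  case (elim k)
  have "M * r k \<le> max M 0 * (r k)\<^sup>2"
    using r_gt_1[OF elim(2)] by (intro mult_mono) (auto simp: power2_eq_square)
  thus ?case using elim by simp
qed

lemma eventually_r_ge_power: "\<forall>\<^sub>F k in sequentially. A ^ k \<le> r k"
proof -
  \<comment> \<open>The square of \<open>A\<close> pays for the first \<open>N\<close> indices, on
    which nothing is known: \<open>k \<le> 2 * (k - N)\<close> once
    \<open>k \<ge> 2 * N\<close>.\<close>
  define B where "B = max 1 (2 * A\<^sup>2)"
  have "\<forall>\<^sub>F k in sequentially. B * r k \<le> r (Suc k)" by (rule eventually_r_Suc)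
  then obtain N where N: "N \<ge> 1" "\<And>k. k \<ge> N \<Longrightarrow> B * r k \<le> r (Suc k)"
    unfolding eventually_sequentially by (metis le_trans max.bounded_iff max.cobounded1)
  have "r (N + k) \<ge> B ^ k" for k
  proof (induction k)
    case 0
    then show ?case using r_gt_1[OF N(1)] by simp
  next
    case (Suc k)
    have "B ^ Suc k \<le> B * r (N + k)" using mult_left_mono[OF Suc, of B] by (simp add: B_def)
    also have "\<dots> \<le> r (N + Suc k)" using N(2)[of "N + k"] by simp
    finally show ?case .
  qed
  then have 1: "r k \<ge> B ^ (k - N)" if "k \<ge> N" for k
    using \<open>r (N + (k - N)) \<ge> B ^ (k - N)\<close> that by simp
  have "\<forall>\<^sub>F k in sequentially. k \<ge> 2 * N" by (rule eventually_ge_at_top)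
  thus ?thesis
  proof eventually_elim
    case (elim k)
    have "\<bar>A\<bar> ^ k \<le> max 1 \<bar>A\<bar> ^ k" by (intro power_mono) auto
    also have "\<dots> \<le> max 1 \<bar>A\<bar> ^ (2 * (k - N))" using elim by (intro power_increasing) auto
    also have "\<dots> = ((max 1 \<bar>A\<bar>)\<^sup>2) ^ (k - N)" by (simp add: power_mult)
    also have "\<dots> \<le> B ^ (k - N)"
      by (intro power_mono) (auto simp: B_def max_def abs_square_le_1 not_le power2_eq_square)
    also have "\<dots> \<le> r k" using elim by (intro 1) auto
    finally show ?case using abs_ge_self[of "A ^ k"] by (simp add: power_abs)
  qed
qed

lemma sum_r_le: "j \<ge> 1 \<Longrightarrow> (\<Sum>i = 1..j. r i) \<le> 2 * r j"
proof (induction j rule: dec_induct)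
  case base
  then show ?case using r1 by simp
next
  case (step j)
  then show ?case using r_double[of j] by simp
qed

lemma sum_inverse_r_le: "1 \<le> j \<Longrightarrow> j \<le> n \<Longrightarrow> (\<Sum>i\<in>{j<..n}. 1 / r i) \<le> 2 / r (Suc j)"
proof -
  assume j: "1 \<le> j" "j \<le> n"
  show ?thesis
  proof (cases "j = n")
    case True
    then show ?thesis using r_pos[of "Suc j"] by simp
  next
    case False
    hence "Suc j \<le> n" using j by simp
    \<comment> \<open>The subtracted term makes the induction go through, since
      \<open>2 / r (Suc n) \<le> 1 / r n\<close>.\<close>
    hence "(\<Sum>i\<in>{j<..n}. 1 / r i) \<le> 2 / r (Suc j) - 1 / r n"
    proof (induction n rule: dec_induct)
      case base
      have "{j<..Suc j} = {Suc j}" by auto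
      then show ?case by simp
    next
      case (step n)
      have "{j<..Suc n} = insert (Suc n) {j<..n}" using step by auto
      moreover have "2 / r (Suc n) \<le> 1 / r n"
        using r_double[of n] r_pos[of n] r_pos[of "Suc n"] step by (simp add: field_simps)
      ultimately show ?case using step by simp
    qed
    moreover have "1 / r n > 0" using r_pos[of n] j by simp
    ultimately show ?thesis by linarith
  qed
qed

lemma summable_inverse_r: "summable (\<lambda>k. 1 / r (Suc k))"
proof (rule summable_comparison_test')
  show "summable (\<lambda>k. (1/2::real) ^ k)" by simp
  show "norm (1 / r (Suc k)) \<le> (1/2) ^ k" if "k \<ge> 0" for k
    using r_ge_power[of "Suc k"] r_pos[of "Suc k"] by (simp add: power_divide frac_le)
qed

text \<open>Absolute convergence allows the square to be taken outside the infinite product. The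
  partial products are indexed from 1 to match the recursion for \<open>r\<close>.\<close>

lemma f_LIMSEQ: "(\<lambda>n. (of_real C)\<^sup>2 * (\<Prod>i = 1..n. (1 + z / of_real (r i)))\<^sup>2) \<longlonglongrightarrow> f z"
proof -
  have "summable (\<lambda>k. norm ((1 + z / of_real (r (k + 1))) - 1))"
  proof -
    have "summable (\<lambda>k. norm z * (1 / r (Suc k)))" by (intro summable_mult summable_inverse_r)
    also have "(\<lambda>k. norm z * (1 / r (Suc k))) = (\<lambda>k. norm ((1 + z / of_real (r (k + 1))) - 1))"
      using r_pos by (auto simp: norm_divide abs_of_pos)
    finally show ?thesis .
  qed
  hence conv: "convergent_prod (\<lambda>k. 1 + z / of_real (r (k + 1)))"
    by (intro abs_convergent_prod_imp_convergent_prod summable_imp_abs_convergent_prod)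
  have "(\<lambda>n. \<Prod>i\<le>n. 1 + z / of_real (r (i + 1))) \<longlonglongrightarrow> (\<Prod>k. 1 + z / of_real (r (k + 1)))"
    by (rule convergent_prod_LIMSEQ[OF conv])
  also have "(\<lambda>n. \<Prod>i\<le>n. 1 + z / of_real (r (i + 1))) = (\<lambda>n. \<Prod>i = 1..Suc n. 1 + z / of_real (r i))"
    by (rule ext, rule prod.reindex_bij_witness[of _ "\<lambda>i. i - 1" Suc]) auto
  finally have "(\<lambda>n. \<Prod>i = 1..n. 1 + z / of_real (r i)) \<longlonglongrightarrow> (\<Prod>k. 1 + z / of_real (r (k + 1)))"
    by (rule LIMSEQ_imp_Suc)
  moreover have "f z = (of_real C)\<^sup>2 * (\<Prod>k. 1 + z / of_real (r (k + 1)))\<^sup>2"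
    by (simp only: f_eq prodinf_power[OF conv])
  ultimately show ?thesis by (auto intro!: tendsto_intros)
qed

text \<open>The partial products converge uniformly on closed discs by the Weierstrass test with the
  summable majorant \<open>(norm z + 1) / r (Suc k)\<close>.\<close>

lemma holomorphic_f: "f holomorphic_on A"
proof -
  define P where "P = (\<lambda>N z. \<Prod>k<N. 1 + z / complex_of_real (r (Suc k)))"
  have "f holomorphic_on UNIV"
  proof (rule holomorphic_uniform_sequence)
    show "(\<lambda>z. (of_real C)\<^sup>2 * (P N z)\<^sup>2) holomorphic_on UNIV" for N
      unfolding P_def using r_pos by (auto intro!: holomorphic_intros simp: less_imp_neq[symmetric])
    fix z :: complex
    have unif: "uniformly_convergent_on (cball z 1) P"
      unfolding P_def
    proof (rule uniformly_convergent_on_prod')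
      show "uniformly_convergent_on (cball z 1) (\<lambda>N x. \<Sum>k<N. norm (1 + x / complex_of_real (r (Suc k)) - 1))"
      proof (rule Weierstrass_m_test')
        fix k and x assume x: "x \<in> cball z 1"
        have "norm x \<le> norm z + 1" using x norm_triangle_ineq2[of x z] by (simp add: dist_norm norm_minus_commute)
        thus "norm (norm (1 + x / complex_of_real (r (Suc k)) - 1)) \<le> (norm z + 1) * (1 / r (Suc k))"
          using r_pos[of "Suc k"] by (simp add: norm_divide divide_right_mono)
      qed (intro summable_mult summable_inverse_r)
      show "continuous_on (cball z 1) (\<lambda>x. 1 + x / complex_of_real (r (Suc n)))" for n
        using r_pos[of "Suc n"] by (intro continuous_intros) auto
    qed auto
    then obtain g where g: "uniform_limit (cball z 1) P g sequentially"
      by (auto simp: uniformly_convergent_on_def)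
    have "continuous_on (cball z 1) (P n)" for n
      unfolding P_def using r_pos by (intro continuous_intros) (auto simp: less_imp_neq[symmetric])
    hence "continuous_on (cball z 1) g"
      using g by (intro uniform_limit_theorem[OF _ g]) auto
    \<comment> \<open>Uniform convergence passes to the squares only because the limit is
      bounded.\<close>
    hence bd: "bounded (g ` cball z 1)"
      by (intro compact_imp_bounded compact_continuous_image) auto
    have "uniform_limit (cball z 1) (\<lambda>N x. (of_real C)\<^sup>2 * (P N x * P N x)) (\<lambda>x. (of_real C)\<^sup>2 * (g x * g x)) sequentially"
      by (intro uniform_limit_intros g bd bounded_linear_uniform_limit_intros)
    also have "?this \<longleftrightarrow> uniform_limit (cball z 1) (\<lambda>N x. (of_real C)\<^sup>2 * (P N x)\<^sup>2) f sequentially"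
    proof (intro uniform_limit_cong always_eventually allI ballI)
      fix x assume x: "x \<in> cball z 1"
      have "(\<lambda>N. (of_real C)\<^sup>2 * (P N x)\<^sup>2) \<longlonglongrightarrow> (of_real C)\<^sup>2 * (g x)\<^sup>2"
        using tendsto_uniform_limitI[OF g x] by (intro tendsto_intros)
      moreover have "P N x = (\<Prod>i = 1..N. (1 + x / of_real (r i)))" for N
        unfolding P_def by (rule prod.reindex_bij_witness[of _ "\<lambda>i. i - 1" Suc]) auto
      ultimately show "(of_real C)\<^sup>2 * (g x * g x) = f x"
        using f_LIMSEQ[of x] LIMSEQ_unique by (force simp: power2_eq_square)
    qed (simp add: power2_eq_square)
    finally show "\<exists>d>0. cball z d \<subseteq> UNIV \<and>
        uniform_limit (cball z d) (\<lambda>N x. (of_real C)\<^sup>2 * (P N x)\<^sup>2) f sequentially"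
      by (intro exI[of _ 1]) auto
  qed auto
  thus ?thesis by (rule holomorphic_on_subset) auto
qed

section \<open>Asymptotics of the product\<close>


lemma r_Suc_eq: "k0 \<le> j \<Longrightarrow> r (Suc j) = C\<^sup>2 * (\<Prod>i = 1..j. 1 + r j / r i)\<^sup>2"
  using r_rec[of j] by (simp add: prod_power_distrib)

lemma eventually_sum_r: "\<forall>\<^sub>F j in sequentially. M * (\<Sum>i\<in>{1..<j}. r i) \<le> r j"
proof -
  have "\<forall>\<^sub>F k in sequentially. M * (\<Sum>i\<in>{1..<Suc k}. r i) \<le> r (Suc k)"
    using eventually_r_Suc[of "2 * \<bar>M\<bar>"] eventually_ge_at_top[of 1]
  proof eventually_elim
    case (elim k)
    have nn: "0 \<le> (\<Sum>i = 1..k. r i)" using r_pos by (intro sum_nonneg) (auto intro: less_imp_le)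
    have "M * (\<Sum>i = 1..k. r i) \<le> \<bar>M\<bar> * (\<Sum>i = 1..k. r i)"
      using nn by (intro mult_right_mono) auto
    also have "\<dots> \<le> \<bar>M\<bar> * (2 * r k)" using sum_r_le[OF elim(2)] by (intro mult_left_mono) auto
    also have "\<dots> \<le> r (Suc k)" using elim(1) by (simp add: mult_ac)
    finally show ?case by (simp add: atLeastLessThanSuc_atLeastAtMost)
  qed
  thus ?thesis by (simp only: eventually_sequentially_Suc[of "\<lambda>j. M * (\<Sum>i\<in>{1..<j}. r i) \<le> r j"])
qed

lemma prod_split_tail:
  assumes "j \<le> n"
  shows "(\<Prod>i = 1..n. 1 + z / complex_of_real (r i)) =
    (\<Prod>i = 1..j. 1 + z / complex_of_real (r i)) * (\<Prod>i\<in>{j<..n}. 1 + z / complex_of_real (r i))"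
proof -
  have "{1..n} = {1..j} \<union> {j<..n}" using assms by auto
  show ?thesis unfolding \<open>{1..n} = {1..j} \<union> {j<..n}\<close> by (rule prod.union_disjoint) auto
qed

text \<open>The zeros beyond \<open>r j\<close> change the product only by the factor
  \<open>t\<close>, as \<open>norm z / r i\<close> is summably small there. The radius
  \<open>300 * r j\<close> leaves room for \<open>exp 5 \<le> 243\<close>.\<close>

lemma eventually_f_tail:
  "\<forall>\<^sub>F j in sequentially. \<forall>z. norm z \<le> 300 * r j \<longrightarrow> (\<exists>t. norm (t - 1) \<le> 1/100 \<and>
     f z = (of_real C)\<^sup>2 * (\<Prod>i = 1..j. 1 + z / of_real (r i))\<^sup>2 * t)"
  \<comment> \<open>The sum over the tail is at most \<open>300 * 2 * r j / r (Suc j)\<close>, which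
    has to be at most \<open>1/1000\<close>.\<close>
  using eventually_r_Suc[of 600000] eventually_ge_at_top[of 1]
proof eventually_elim
  case (elim j)
  show ?case
  proof (intro allI impI)
    fix z :: complex assume z: "norm z \<le> 300 * r j"
    define P where "P = (\<Prod>i = 1..j. 1 + z / complex_of_real (r i))"
    define T where "T n = (\<Prod>i\<in>{j<..n}. 1 + z / complex_of_real (r i))\<^sup>2" for n
    have "\<forall>\<^sub>F n in sequentially. (of_real C)\<^sup>2 * (\<Prod>i = 1..n. (1 + z / of_real (r i)))\<^sup>2 = (of_real C)\<^sup>2 * P\<^sup>2 * T n"
      using eventually_ge_at_top[of j]
      by eventually_elim (simp only: prod_split_tail P_def T_def power_mult_distrib mult.assoc)
    from tendsto_cong[OF this] have lim: "(\<lambda>n. (of_real C)\<^sup>2 * P\<^sup>2 * T n) \<longlonglongrightarrow> f z"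
      using f_LIMSEQ[of z] by simp
    have T: "norm (T n - 1) \<le> 1/100" if "n \<ge> j" for n
      unfolding T_def
    proof (rule norm_prod_squared_minus_1_le)
      have "(\<Sum>i\<in>{j<..n}. norm (z / complex_of_real (r i))) = norm z * (\<Sum>i\<in>{j<..n}. 1 / r i)"
        using r_pos by (simp add: sum_distrib_left norm_divide abs_of_pos)
      also have "\<dots> \<le> (300 * r j) * (2 / r (Suc j))"
        using sum_inverse_r_le[of j n] elim that z r_pos by (intro mult_mono sum_nonneg) (auto intro: less_imp_le)
      also have "\<dots> \<le> 1/1000" using elim r_pos[of "Suc j"] by (simp add: field_simps)
      finally show "(\<Sum>i\<in>{j<..n}. norm (z / complex_of_real (r i))) \<le> 1/1000" .
    qed
    show "\<exists>t. norm (t - 1) \<le> 1/100 \<and>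
     f z = (of_real C)\<^sup>2 * (\<Prod>i = 1..j. 1 + z / of_real (r i))\<^sup>2 * t"
    \<comment> \<open>At a zero of the head the quotient defining \<open>t\<close> is meaningless,
      but \<open>f z = 0\<close> and any admissible \<open>t\<close> will do.\<close>
    proof (cases "P = 0")
      case True
      hence "f z = 0" using lim LIMSEQ_unique[OF lim, of 0] by simp
      thus ?thesis using True by (intro exI[of _ 1]) (simp add: P_def)
    next
      case False
      define D where "D = (of_real C)\<^sup>2 * P\<^sup>2"
      have D: "D \<noteq> 0" using False C_pos by (simp add: D_def)
      have "(\<lambda>n. D * T n / D) \<longlonglongrightarrow> f z / D"
        using lim D by (intro tendsto_intros) (simp_all add: D_def)
      hence "T \<longlonglongrightarrow> f z / D" using D by simp
      hence "(\<lambda>n. norm (T n - 1)) \<longlonglongrightarrow> norm (f z / D - 1)" by (intro tendsto_intros)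
      hence "norm (f z / D - 1) \<le> 1/100"
        by (rule LIMSEQ_le_const2) (use T in auto)
      thus ?thesis using D by (intro exI[of _ "f z / D"]) (simp add: D_def P_def)
    qed
  qed
qed

lemma f_of_real_LIMSEQ:
  "(\<lambda>n. C\<^sup>2 * (\<Prod>i = 1..n. 1 + x / r i)\<^sup>2) \<longlonglongrightarrow> Re (f (of_real x))"
  "f (of_real x) = of_real (Re (f (of_real x)))"
proof -
  have 1: "(\<lambda>n. complex_of_real (C\<^sup>2 * (\<Prod>i = 1..n. 1 + x / r i)\<^sup>2)) \<longlonglongrightarrow> f (of_real x)"
    using f_LIMSEQ[of "of_real x"] by simp
  show "(\<lambda>n. C\<^sup>2 * (\<Prod>i = 1..n. 1 + x / r i)\<^sup>2) \<longlonglongrightarrow> Re (f (of_real x))"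
    using tendsto_Re[OF 1] by (simp only: Re_complex_of_real)
  have "(\<lambda>n. 0) \<longlonglongrightarrow> Im (f (of_real x))"
    using tendsto_Im[OF 1] by (simp only: Im_complex_of_real)
  hence "Im (f (of_real x)) = 0" using LIMSEQ_unique[OF tendsto_const] by metis
  thus "f (of_real x) = of_real (Re (f (of_real x)))" by (simp add: complex_eq_iff)
qed

text \<open>All zeros are negative, so every factor increases on the positive axis. This controls
  \<open>f\<close> along a real segment by its values at the two ends.\<close>

lemma f_of_real_mono:
  assumes "0 \<le> x" "x \<le> y"
  shows "Re (f (of_real x)) \<le> Re (f (of_real y))"
proof (rule LIMSEQ_le[OF f_of_real_LIMSEQ(1) f_of_real_LIMSEQ(1)])
  show "\<exists>N. \<forall>n\<ge>N. C\<^sup>2 * (\<Prod>i = 1..n. 1 + x / r i)\<^sup>2 \<le> C\<^sup>2 * (\<Prod>i = 1..n. 1 + y / r i)\<^sup>2"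
    using assms r_pos
    by (intro exI[of _ 0] allI impI mult_left_mono power_mono prod_mono prod_nonneg)
       (auto intro!: divide_right_mono add_nonneg_nonneg divide_nonneg_pos simp: less_imp_le)
qed

lemma f_of_real_pos: "0 \<le> x \<Longrightarrow> Re (f (of_real x)) > 0"
proof -
  assume x: "0 \<le> x"
  have "C\<^sup>2 \<le> Re (f (of_real 0))"
    by (rule LIMSEQ_le_const[OF f_of_real_LIMSEQ(1)]) simp
  also have "\<dots> \<le> Re (f (of_real x))" by (rule f_of_real_mono) (use x in auto)
  finally show ?thesis using C_pos by (smt (verit) zero_less_power)
qed

lemma norm_f_of_real: "0 \<le> x \<Longrightarrow> norm (f (of_real x)) = Re (f (of_real x))"
  using f_of_real_pos[of x] f_of_real_LIMSEQ(2)[of x] by (metis abs_of_pos norm_of_real)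

lemma exp_5_le: "exp 5 \<le> (243::real)"
proof -
  have "exp (5::real) = exp 1 ^ 5" by (simp flip: exp_of_nat_mult)
  also have "\<dots> \<le> 3 ^ 5" by (intro power_mono exp_le) auto
  finally show ?thesis by simp
qed

text \<open>On the scale of \<open>r j\<close>, the \<open>j - 1\<close> smaller zeros act like a zero at the origin
  and the larger zeros are invisible.\<close>

lemma eventually_f_asymp:
  "\<forall>\<^sub>F j in sequentially. \<forall>u. \<bar>Re u\<bar> \<le> 5 \<longrightarrow> (\<exists>w. norm (w - 1) \<le> 1/10 \<and>
     f (of_real (r j) * exp u) =
       of_real (r (Suc j)) * exp (of_nat (2 * (j - 1)) * u) * ((1 + exp u) / 2)\<^sup>2 * w)"
  using eventually_f_tail eventually_sum_r[of 244000] eventually_ge_at_top[of "max k0 1"]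
proof eventually_elim
  case (elim j)
  show ?case
  proof (intro allI impI)
    fix u :: complex assume u: "\<bar>Re u\<bar> \<le> 5"
    have j: "j \<ge> 1" "j \<ge> k0" using elim by auto
    have rj: "r j > 0" using r_pos j by simp
    have e1: "exp (Re u) \<le> 243" "exp (- Re u) \<le> 243"
      using u by (intro order_trans[OF _ exp_5_le]; simp)+
    define z where "z = of_real (r j) * exp u"
    have "norm z \<le> 300 * r j" using e1 rj by (simp add: z_def norm_mult mult.commute)
    then obtain t where t: "norm (t - 1) \<le> 1/100"
      "f z = (of_real C)\<^sup>2 * (\<Prod>i = 1..j. 1 + z / of_real (r i))\<^sup>2 * t" using elim by blast
    \<comment> \<open>The exact error when \<open>exp u * (1 + r j / r i)\<close> is factored out of
      \<open>1 + z / r i\<close>. It is of size \<open>r i / r j\<close>, hence the constant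
      \<open>244 * 1000\<close> in the bound for the sum of the smaller zeros.\<close>
    define a where "a i = (exp (-u) - 1) * of_real (r i / (r i + r j))" for i
    define Q where "Q = (\<Prod>i\<in>{1..<j}. 1 + a i)\<^sup>2"
    define R where "R = (\<Prod>i\<in>{1..<j}. 1 + r j / r i)"
    have Q: "norm (Q - 1) \<le> 1/100"
      unfolding Q_def
    proof (rule norm_prod_squared_minus_1_le)
      have "norm (a i) \<le> 244 * (r i / r j)" if "i \<in> {1..<j}" for i
      proof -
        have ri: "r i > 0" using r_pos that by simp
        have "norm (exp (-u) - 1) \<le> 243 + 1"
          using norm_triangle_ineq4[of "exp (-u)" 1] e1 by simp
        moreover have "r i / (r i + r j) \<le> r i / r j" using ri rj by (intro divide_left_mono) auto
        ultimately have "norm (exp (-u) - 1) * (r i / (r i + r j)) \<le> 244 * (r i / r j)"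
          using ri rj by (intro mult_mono) auto
        thus ?thesis using ri rj by (simp add: a_def norm_mult norm_divide abs_of_pos add_pos_pos flip: of_real_add)
      qed
      hence "(\<Sum>i\<in>{1..<j}. norm (a i)) \<le> (\<Sum>i\<in>{1..<j}. 244 * (r i / r j))" by (rule sum_mono)
      also have "\<dots> = 244 * (\<Sum>i\<in>{1..<j}. r i) / r j"
        by (simp add: sum_distrib_left sum_divide_distrib)
      also have "\<dots> \<le> 1/1000" using elim(2) rj by (simp add: field_simps)
      finally show "(\<Sum>i\<in>{1..<j}. norm (a i)) \<le> 1/1000" .
    qed
    have ins: "{1..j} = insert j {1..<j}" using j by auto
    have fac: "1 + z / of_real (r i) = exp u * of_real (1 + r j / r i) * (1 + a i)" if "i \<in> {1..<j}" for i
    proof -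
      have ri: "r i > 0" using r_pos that by simp
      have "of_real (1 + r j / r i) * a i = exp (-u) - 1"
      proof -
        have "1 + r j / r i = (r i + r j) / r i" "r i + r j > 0" using ri rj by (simp_all add: field_simps)
        hence "(1 + r j / r i) * (r i / (r i + r j)) = 1" using ri by simp
        hence "of_real ((1 + r j / r i) * (r i / (r i + r j))) = (1::complex)" by (simp only: of_real_1)
        thus ?thesis unfolding a_def of_real_mult by (metis mult.left_commute mult.right_neutral)
      qed
      hence "exp u * of_real (1 + r j / r i) * (1 + a i) = exp u * of_real (1 + r j / r i) + exp u * exp (-u) - exp u"
        by (simp only: distrib_left mult_1_right mult.assoc right_diff_distrib add_diff_eq)
      also have "exp u * exp (-u) = 1" by (simp add: exp_minus)
      finally show ?thesis by (simp add: z_def algebra_simps)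
    qed
    have "(\<Prod>i\<in>{1..<j}. 1 + z / of_real (r i)) =
        exp u ^ (j - 1) * of_real R * (\<Prod>i\<in>{1..<j}. 1 + a i)"
      by (simp only: fac prod.distrib cong: prod.cong) (simp add: R_def)
    moreover have "1 + z / of_real (r j) = 1 + exp u" using rj by (simp add: z_def)
    ultimately have "(\<Prod>i = 1..j. 1 + z / of_real (r i)) =
        (1 + exp u) * (exp u ^ (j - 1) * of_real R * (\<Prod>i\<in>{1..<j}. 1 + a i))"
      unfolding ins by (subst prod.insert) auto
    hence "f z = (of_real C)\<^sup>2 * ((1 + exp u) * (exp u ^ (j - 1) * of_real R))\<^sup>2 * (Q * t)"
      by (simp add: t(2) Q_def power_mult_distrib)
    \<comment> \<open>The recursion is the same finite product at \<open>u = 0\<close>, where the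
      factor of index \<open>j\<close> equals 2; this is the source of the denominator in
      \<open>(1 + exp u) / 2\<close>.\<close>
    moreover have "r (Suc j) = C\<^sup>2 * (2 * R)\<^sup>2"
    proof -
      have "(\<Prod>i = 1..j. 1 + r j / r i) = 2 * R" using rj unfolding ins R_def by (subst prod.insert) auto
      thus ?thesis by (simp add: r_Suc_eq[OF j(2)])
    qed
    moreover have "exp (of_nat (2 * (j - 1)) * u) = (exp u ^ (j - 1))\<^sup>2"
      by (simp only: exp_of_nat_mult power_mult mult.commute[of 2])
    ultimately have "f z = of_real (r (Suc j)) * exp (of_nat (2 * (j - 1)) * u) * ((1 + exp u) / 2)\<^sup>2 * (Q * t)"
      by (simp add: power_mult_distrib power_divide)
    moreover have "norm (Q * t - 1) \<le> 1/10"
    proof -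
      have "Q * t - 1 = (Q - 1) + (Q - 1) * (t - 1) + (t - 1)" by (simp add: algebra_simps)
      hence "norm (Q * t - 1) \<le> norm (Q - 1) + norm (Q - 1) * norm (t - 1) + norm (t - 1)"
        by (metis norm_triangle_le norm_mult order_refl add_mono norm_triangle_ineq)
      also have "\<dots> \<le> 1/100 + 1/100 * (1/100) + 1/100" using Q t(1) by (intro add_mono mult_mono) auto
      finally show ?thesis by simp
    qed
    ultimately show "\<exists>w. norm (w - 1) \<le> 1/10 \<and> f (of_real (r j) * exp u) =
       of_real (r (Suc j)) * exp (of_nat (2 * (j - 1)) * u) * ((1 + exp u) / 2)\<^sup>2 * w"
      unfolding z_def by blast
  qed
qed

text \<open>Both radii are fixed multiples of consecutive zeros, in contrast to Baker's inner radius
  \<open>r j ^ 2\<close>. The annulus thus reaches the scale of \<open>r (Suc j)\<close> in bounded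
  logarithmic distance.\<close>

definition annulus :: "nat \<Rightarrow> complex set" where
  "annulus j = {z. 5 * r j < norm z \<and> norm z < r (Suc j) / 8}"

text \<open>Each factor of \<open>f z\<close> is compared with the corresponding factor of the
  recursion, for \<open>r (Suc (Suc j))\<close> from above and for \<open>r (Suc j)\<close> from
  below; the gains \<open>9/16\<close> and 2 per factor accumulate.\<close>

lemma eventually_f_annulus: "\<forall>\<^sub>F j in sequentially. f ` annulus j \<subseteq> annulus (Suc j)"
  \<comment> \<open>The index is shifted so that the zero at \<open>- r (Suc j)\<close>, which is
    not negligible on this annulus, belongs to the head.\<close>
  using eventually_f_tail[THEN eventually_sequentially_Suc[THEN iffD2]]
    eventually_ge_at_top[of "max k0 2"]
proof eventually_elim
  case (elim j)
  have j: "j \<ge> 2" "j \<ge> k0" using elim by auto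
  have ins: "{1..Suc j} = insert (Suc j) {1..j}" by auto
  show ?case
  proof safe
    fix z assume z: "z \<in> annulus j"
    have rs: "r (Suc j) > 0" using r_pos by simp
    have "norm z \<le> 300 * r (Suc j)" using z rs by (simp add: annulus_def)
    then obtain t where t: "norm (t - 1) \<le> 1/100"
      "f z = (of_real C)\<^sup>2 * (\<Prod>i = 1..Suc j. 1 + z / of_real (r i))\<^sup>2 * t" using elim by blast
    have tn: "99/100 \<le> norm t" "norm t \<le> 101/100"
      using t(1) norm_triangle_ineq2[of 1 t] norm_triangle_ineq2[of t 1] by (simp_all add: norm_minus_commute)
    have nf: "norm (f z) = C\<^sup>2 * (\<Prod>i = 1..Suc j. norm (1 + z / of_real (r i)))\<^sup>2 * norm t"
      unfolding t(2) norm_mult norm_power prod_norm[symmetric] by (simp add: norm_power)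
    have "norm (f z) < r (Suc (Suc j)) / 8"
    proof -
      \<comment> \<open>For \<open>x = r (Suc j) / r i \<ge> 1\<close> one has
        \<open>1 + x / 8 \<le> 9/16 * (1 + x)\<close>.\<close>
      have "(\<Prod>i = 1..Suc j. norm (1 + z / of_real (r i))) \<le> (\<Prod>i = 1..Suc j. 9/16 * (1 + r (Suc j) / r i))"
      proof (intro prod_mono conjI)
        fix i assume i: "i \<in> {1..Suc j}"
        have ri: "0 < r i" "r i \<le> r (Suc j)" using i r_pos[of i] r_mono[of i "Suc j"] by auto
        have "norm (1 + z / of_real (r i)) \<le> 1 + norm z / r i"
          using norm_triangle_ineq[of 1 "z / of_real (r i)"] ri by (simp add: norm_divide)
        also have "\<dots> \<le> 1 + (r (Suc j) / 8) / r i" using z ri by (intro add_left_mono divide_right_mono) (auto simp: annulus_def)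
        also have "\<dots> \<le> 9/16 * (1 + r (Suc j) / r i)" using ri by (simp add: field_simps)
        finally show "norm (1 + z / of_real (r i)) \<le> 9/16 * (1 + r (Suc j) / r i)" .
      qed auto
      also have "\<dots> = (9/16) ^ Suc j * (\<Prod>i = 1..Suc j. 1 + r (Suc j) / r i)"
        unfolding prod.distrib by simp
      finally have "(\<Prod>i = 1..Suc j. norm (1 + z / of_real (r i)))\<^sup>2 \<le> ((9/16) ^ Suc j * (\<Prod>i = 1..Suc j. 1 + r (Suc j) / r i))\<^sup>2"
        by (intro power_mono prod_nonneg) auto
      hence "norm (f z) \<le> C\<^sup>2 * ((9/16) ^ Suc j * (\<Prod>i = 1..Suc j. 1 + r (Suc j) / r i))\<^sup>2 * (101/100)"
        unfolding nf using tn by (intro mult_mono) auto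
      also have "\<dots> = ((9/16) ^ Suc j)\<^sup>2 * (101/100) * r (Suc (Suc j))"
        using r_Suc_eq[of "Suc j"] j by (simp only: power_mult_distrib le_SucI mult_ac)
      also have "\<dots> \<le> ((9/16) ^ 2)\<^sup>2 * (101/100) * r (Suc (Suc j))"
        using j r_pos[of "Suc (Suc j)"] by (intro mult_right_mono power_mono power_decreasing) auto
      also have "\<dots> < r (Suc (Suc j)) / 8" using r_pos[of "Suc (Suc j)"] by (simp add: power2_eq_square)
      finally show ?thesis .
    qed
    moreover have "norm (f z) > 5 * r (Suc j)"
    proof -
      \<comment> \<open>For \<open>x = r j / r i \<ge> 1\<close> one has
        \<open>2 * (1 + x) \<le> 5 * x - 1\<close>; the last factor, with
        \<open>norm z < r (Suc j) / 8\<close>, costs \<open>7/8\<close>.\<close>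
      have "(\<Prod>i = 1..j. 2 * (1 + r j / r i)) * (7/8) \<le> (\<Prod>i = 1..j. norm (1 + z / of_real (r i))) * norm (1 + z / of_real (r (Suc j)))"
      proof (intro mult_mono prod_mono conjI)
        fix i assume i: "i \<in> {1..j}"
        have ri: "0 < r i" "r i \<le> r j" using i r_pos[of i] r_mono[of i j] by auto
        have "2 * (1 + r j / r i) \<le> (5 * r j) / r i - 1" using ri by (simp add: field_simps)
        also have "\<dots> \<le> norm z / r i - 1" using z ri by (intro diff_right_mono divide_right_mono) (auto simp: annulus_def)
        also have "\<dots> \<le> norm (1 + z / of_real (r i))"
          using norm_diff_ineq[of "z / of_real (r i)" 1] ri by (simp add: norm_divide add.commute)
        finally show "2 * (1 + r j / r i) \<le> norm (1 + z / of_real (r i))" .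
        show "0 \<le> 2 * (1 + r j / r i)" using ri by simp
      next
        have "norm z / r (Suc j) \<le> 1/8" using z rs by (simp add: annulus_def field_simps)
        moreover have "1 - norm z / r (Suc j) \<le> norm (1 + z / of_real (r (Suc j)))"
          using norm_diff_ineq[of 1 "z / of_real (r (Suc j))"] rs by (simp add: norm_divide)
        ultimately show "7/8 \<le> norm (1 + z / of_real (r (Suc j)))" by linarith
      qed (auto intro!: prod_nonneg)
      also have "\<dots> = (\<Prod>i = 1..Suc j. norm (1 + z / of_real (r i)))" by simp
      finally have le: "(\<Prod>i = 1..j. 2 * (1 + r j / r i)) * (7/8) \<le> (\<Prod>i = 1..Suc j. norm (1 + z / of_real (r i)))" .
      have pos: "0 \<le> (\<Prod>i = 1..j. 2 * (1 + r j / r i))"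
        using r_pos j by (intro prod_nonneg) (auto intro!: add_nonneg_nonneg divide_nonneg_nonneg simp: less_imp_le)
      have "5 * r (Suc j) < 4 ^ 2 * (49/64) * (99/100) * r (Suc j)" using rs by simp
      also have "\<dots> \<le> 4 ^ j * (49/64) * (99/100) * r (Suc j)"
        using j rs by (intro mult_right_mono power_increasing) auto
      also have "\<dots> = C\<^sup>2 * ((\<Prod>i = 1..j. 2 * (1 + r j / r i)) * (7/8))\<^sup>2 * (99/100)"
      proof -
        have "(2 ^ j)\<^sup>2 = (4::real) ^ j" using power_mult_distrib[of 2 "2::real" j] by (simp add: power2_eq_square)
        thus ?thesis unfolding r_Suc_eq[OF j(2)] prod.distrib
          by (simp add: power_mult_distrib power_divide)
      qed
      also have "\<dots> \<le> norm (f z)"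
        unfolding nf using tn le pos C_pos by (intro mult_mono power_mono) auto
      finally show ?thesis .
    qed
    ultimately show "f z \<in> annulus (Suc j)" by (simp add: annulus_def)
  qed
qed

end

section \<open>Inverse branches in logarithmic coordinates\<close>

lemma norm_Ln_le_3:
  assumes "Re z > 0" "1/2 \<le> norm z" "norm z \<le> 2"
  shows "norm (Ln z) \<le> 3"
proof -
  have z: "z \<noteq> 0" using assms by auto
  have "\<bar>Im (Ln z)\<bar> < pi / 2" using Re_Ln_pos_lt[OF z] assms by simp
  hence im: "\<bar>Im (Ln z)\<bar> \<le> 2" using pi_less_4 by linarith
  have "ln (norm z) \<le> ln 2" using assms(3) z by simp
  moreover have "ln (1/2) \<le> ln (norm z)" using assms(2) z by (subst ln_le_cancel_iff) auto
  hence "- ln 2 \<le> ln (norm z)" by (simp add: ln_div)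
  moreover have "Re (Ln z) = ln (norm z)" using z by simp
  ultimately have "\<bar>Re (Ln z)\<bar> \<le> ln 2" by linarith
  also have "ln 2 \<le> (1::real)" using ln_2_less_1 by simp
  finally show ?thesis using cmod_le[of "Ln z"] im by linarith
qed

text \<open>Cauchy's estimate on discs of radius \<open>1/3\<close> bounds the derivative by
  \<open>13 * 3 = 39\<close>; 13 replaces 12 because the values must lie in an open ball.\<close>

lemma bounded_holomorphic_lipschitz:
  fixes K :: "complex \<Rightarrow> complex"
  assumes hol: "K holomorphic_on ball 0 1" and bd: "\<And>u. u \<in> ball 0 1 \<Longrightarrow> norm (K u) \<le> 12"
    and uv: "u \<in> cball 0 (1/2)" "v \<in> cball 0 (1/2)"
  shows "dist (K u) (K v) \<le> 40 * dist u v"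
proof -
  have "norm (K u - K v) \<le> 40 * norm (u - v)"
  proof (rule field_differentiable_bound[OF convex_cball _ _ uv])
    fix z :: complex assume z: "z \<in> cball 0 (1/2)"
    have sub: "cball z (1/3) \<subseteq> ball 0 1"
    proof
      fix w assume "w \<in> cball z (1/3)"
      hence "norm (w - z) \<le> 1/3" by (simp add: dist_norm norm_minus_commute)
      thus "w \<in> ball 0 1" using z norm_triangle_ineq[of "w - z" z] by simp
    qed
    have zb: "z \<in> ball 0 1" using z by simp
    show "(K has_field_derivative deriv K z) (at z within cball 0 (1/2))"
      by (rule has_field_derivative_at_within[OF holomorphic_derivI[OF hol open_ball zb]])
    have "norm ((deriv ^^ 1) K z) \<le> fact 1 * 13 / (1/3) ^ 1"
    proof (rule Cauchy_higher_deriv_bound)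
      show "K holomorphic_on ball z (1/3)"
        by (rule holomorphic_on_subset[OF hol order_trans[OF ball_subset_cball sub]])
      show "continuous_on (cball z (1/3)) K"
        by (rule holomorphic_on_imp_continuous_on[OF holomorphic_on_subset[OF hol sub]])
      show "K w \<in> ball 0 13" if "w \<in> ball z (1/3)" for w
        using bd[of w] sub that ball_subset_cball[of z "1/3"] by force
    qed auto
    thus "norm (deriv K z) \<le> 40" by simp
  qed
  thus ?thesis by (simp add: dist_norm)
qed

context baker_product
begin

text \<open>Both \<open>(1 + exp u) / 2\<close> and the relative error lie in the right half plane
  with modulus between \<open>1/2\<close> and 2 on the unit disc, so their principal logarithms are
  bounded and holomorphic. The reality of \<open>K\<close> on the real axis serves to locate the
  preimage of \<open>-3\<close>.\<close>

lemma eventually_log_form: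
  "\<forall>\<^sub>F j in sequentially. \<exists>K.
     (\<forall>u\<in>cball 0 (1/2). f (of_real (r j) * exp u) = of_real (r (Suc j)) * exp (of_nat (2 * (j - 1)) * u + K u)) \<and>
     (\<forall>u\<in>cball 0 (1/2). norm (K u) \<le> 12) \<and>
     (\<forall>u\<in>cball 0 (1/2). \<forall>v\<in>cball 0 (1/2). dist (K u) (K v) \<le> 40 * dist u v) \<and>
     (\<forall>x. \<bar>x\<bar> \<le> 1/2 \<longrightarrow> K (of_real x) \<in> \<real>)"
  using eventually_f_asymp eventually_ge_at_top[of 1]
proof eventually_elim
  case (elim j)
  define c where "c = (of_nat (2 * (j - 1)) :: complex)"
  \<comment> \<open>The relative error written as a quotient, which makes it holomorphic in
    \<open>u\<close>; the asymptotics only provide it pointwise.\<close>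
  define \<Psi> where "\<Psi> u = f (of_real (r j) * exp u) / (of_real (r (Suc j)) * exp (c * u) * ((1 + exp u) / 2)\<^sup>2)" for u
  define K where "K u = 2 * Ln ((1 + exp u) / 2) + Ln (\<Psi> u)" for u
  have rs: "r (Suc j) > 0" "r j > 0" using r_pos elim by auto
  have E: "Re ((1 + exp u) / 2) > 0" "1/2 \<le> norm ((1 + exp u) / 2)" "norm ((1 + exp u) / 2) \<le> 2"
    if u: "u \<in> ball 0 1" for u
  proof -
    have "\<bar>Re u\<bar> \<le> 1" "\<bar>Im u\<bar> \<le> 1" using u abs_Re_le_cmod[of u] abs_Im_le_cmod[of u] by auto
    hence "cos (Im u) > 0" using pi_gt3 by (intro cos_gt_zero_pi) auto
    hence re: "Re (exp u) > 0" by (simp add: Re_exp)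
    thus "Re ((1 + exp u) / 2) > 0" by simp
    have "1 \<le> Re (1 + exp u)" using re by simp
    also have "\<dots> \<le> norm (1 + exp u)" by (rule complex_Re_le_cmod)
    finally show "1/2 \<le> norm ((1 + exp u) / 2)" by (simp add: norm_divide)
    have "norm (exp u) \<le> exp 1" using \<open>\<bar>Re u\<bar> \<le> 1\<close> by simp
    also have "\<dots> \<le> 3" by (rule exp_le)
    finally show "norm ((1 + exp u) / 2) \<le> 2" using norm_triangle_ineq[of 1 "exp u"] by (simp add: norm_divide)
  qed
  have \<Psi>: "norm (\<Psi> u - 1) \<le> 1/10" and f\<Psi>: "f (of_real (r j) * exp u) = of_real (r (Suc j)) * exp (c * u) * ((1 + exp u) / 2)\<^sup>2 * \<Psi> u"
    if u: "u \<in> ball 0 1" for u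
  proof -
    have "\<bar>Re u\<bar> \<le> 5" using u abs_Re_le_cmod[of u] by auto
    then obtain w where w: "norm (w - 1) \<le> 1/10"
      "f (of_real (r j) * exp u) = of_real (r (Suc j)) * exp (c * u) * ((1 + exp u) / 2)\<^sup>2 * w"
      using elim(1) unfolding c_def by blast
    have "of_real (r (Suc j)) * exp (c * u) * ((1 + exp u) / 2)\<^sup>2 \<noteq> 0"
      using E(2)[OF u] rs by auto
    hence "\<Psi> u = w" unfolding \<Psi>_def w(2) by (rule nonzero_mult_div_cancel_left)
    thus "norm (\<Psi> u - 1) \<le> 1/10" "f (of_real (r j) * exp u) = of_real (r (Suc j)) * exp (c * u) * ((1 + exp u) / 2)\<^sup>2 * \<Psi> u"
      using w by auto
  qed
  have P: "Re (\<Psi> u) > 0" "1/2 \<le> norm (\<Psi> u)" "norm (\<Psi> u) \<le> 2" if u: "u \<in> ball 0 1" for u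
    using \<Psi>[OF u] abs_Re_le_cmod[of "\<Psi> u - 1"] norm_triangle_ineq2[of 1 "\<Psi> u"] norm_triangle_ineq2[of "\<Psi> u" 1]
    by (auto simp: norm_minus_commute)
  have K12: "norm (K u) \<le> 12" if u: "u \<in> ball 0 1" for u
    using norm_Ln_le_3[OF E[OF u]] norm_Ln_le_3[OF P[OF u]] norm_triangle_ineq[of "2 * Ln ((1 + exp u) / 2)" "Ln (\<Psi> u)"]
    by (simp add: K_def norm_mult)
  have expK: "f (of_real (r j) * exp u) = of_real (r (Suc j)) * exp (c * u + K u)" if u: "u \<in> ball 0 1" for u
  proof -
    have nz: "(1 + exp u) / 2 \<noteq> 0" "\<Psi> u \<noteq> 0" using E(2)[OF u] P(2)[OF u] by auto
    have "exp (K u) = ((1 + exp u) / 2)\<^sup>2 * \<Psi> u"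
      unfolding K_def exp_add exp_double exp_Ln[OF nz(1)] exp_Ln[OF nz(2)] ..
    thus ?thesis using f\<Psi>[OF u] by (simp add: exp_add)
  qed
  have hol: "K holomorphic_on ball 0 1"
  proof -
    have hf: "(\<lambda>u. f (of_real (r j) * exp u)) holomorphic_on ball 0 1"
      by (rule holomorphic_on_compose[OF _ holomorphic_f, unfolded o_def]) (intro holomorphic_intros)
    have "\<Psi> holomorphic_on ball 0 1"
      unfolding \<Psi>_def
    proof (intro holomorphic_intros hf)
      fix u :: complex assume "u \<in> ball 0 1"
      from E(2)[OF this] show "of_real (r (Suc j)) * exp (c * u) * ((1 + exp u) / 2)\<^sup>2 \<noteq> 0"
        using rs by auto
    qed simp
    moreover have "(1 + exp u) / 2 \<notin> \<real>\<^sub>\<le>\<^sub>0" "\<Psi> u \<notin> \<real>\<^sub>\<le>\<^sub>0" if "u \<in> ball 0 1" for u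
      using E(1)[OF that] P(1)[OF that] by (simp_all only: complex_nonpos_Reals_iff not_le de_Morgan_conj simp_thms)
    ultimately show ?thesis
      unfolding K_def by (intro holomorphic_intros) auto
  qed
  have realK: "K (of_real x) \<in> \<real>" if x: "\<bar>x\<bar> \<le> 1/2" for x
  proof -
    define y where "y = Re (f (of_real (r j * exp x))) / (r (Suc j) * exp (real (2 * (j - 1)) * x) * ((1 + exp x) / 2)\<^sup>2)"
    have "0 < Re (f (of_real (r j * exp x)))" by (rule f_of_real_pos) (use rs in auto)
    moreover have "0 < 1 + exp x" by (simp add: add_pos_pos)
    ultimately have y: "y > 0" using rs unfolding y_def by (intro divide_pos_pos mult_pos_pos) auto
    have fx: "f (of_real (r j) * exp (of_real x)) = of_real (Re (f (of_real (r j * exp x))))"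
      unfolding exp_of_real of_real_mult[symmetric] by (rule f_of_real_LIMSEQ(2))
    have ex: "exp (c * of_real x) = of_real (exp (real (2 * (j - 1)) * x))"
    proof -
      have "c = complex_of_real (real (2 * (j - 1)))" by (simp add: c_def)
      thus ?thesis by (simp only: of_real_mult[symmetric] exp_of_real)
    qed
    have half: "(1 + exp (complex_of_real x)) / 2 = of_real ((1 + exp x) / 2)"
      by (simp add: exp_of_real)
    have "\<Psi> (of_real x) = of_real y"
      unfolding \<Psi>_def fx ex half y_def by (simp only: of_real_divide of_real_mult of_real_power)
    hence "K (of_real x) = 2 * of_real (ln ((1 + exp x) / 2)) + of_real (ln y)"
      using y \<open>0 < 1 + exp x\<close> unfolding K_def half by (simp only: Ln_of_real half_gt_zero_iff)
    thus ?thesis by simp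
  qed
  have sub: "cball 0 (1/2) \<subseteq> (ball 0 1 :: complex set)" by auto
  show ?case
    using expK K12 bounded_holomorphic_lipschitz[OF hol K12] realK sub unfolding c_def
    by (intro exI[of _ K]) auto
qed

text \<open>\<open>H\<close> is \<open>f\<close> in the logarithmic coordinates at
  \<open>r j\<close> and \<open>r (Suc j)\<close>, and \<open>G\<close> its inverse on a disc that
  contains \<open>\<i> * pi\<close>. The reality of \<open>G (-3)\<close> allows a real segment to
  join it to \<open>-3\<close>.\<close>

definition inverse_branch :: "nat \<Rightarrow> (complex \<Rightarrow> complex) \<Rightarrow> (complex \<Rightarrow> complex) \<Rightarrow> real \<Rightarrow> bool" where
  "inverse_branch j H G c \<longleftrightarrow> c \<ge> 100 \<and>
     (\<forall>u\<in>cball 0 (1/2). f (of_real (r j) * exp u) = of_real (r (Suc j)) * exp (H u)) \<and>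
     (\<forall>u\<in>cball 0 (1/2). \<forall>v\<in>cball 0 (1/2). c / 2 * dist u v \<le> dist (H u) (H v) \<and> dist (H u) (H v) \<le> 2 * c * dist u v) \<and>
     (\<forall>w\<in>cball 0 5. norm (G w) \<le> 17 / c \<and> H (G w) = w) \<and>
     (\<forall>u\<in>cball 0 (1/2). H u \<in> cball 0 5 \<longrightarrow> G (H u) = u) \<and>
     continuous_on (cball 0 5) G \<and> G (-3) \<in> \<real>"

lemma eventually_inverse_branch: "\<forall>\<^sub>F j in sequentially. \<exists>H G c. inverse_branch j H G c"
  using eventually_log_form eventually_ge_at_top[of 51]
proof eventually_elim
  case (elim j)
  define c where "c = real (2 * (j - 1))"
  have c: "c \<ge> 100" and oc: "of_nat (2 * (j - 1)) = complex_of_real c" using elim(2) by (auto simp: c_def)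
  from elim(1) obtain K where
    K1: "\<And>u. u \<in> cball 0 (1/2) \<Longrightarrow> f (of_real (r j) * exp u) = of_real (r (Suc j)) * exp (of_real c * u + K u)"
    and K2: "\<And>u. u \<in> cball 0 (1/2) \<Longrightarrow> norm (K u) \<le> 12"
    and K3: "\<And>u v. u \<in> cball 0 (1/2) \<Longrightarrow> v \<in> cball 0 (1/2) \<Longrightarrow> dist (K u) (K v) \<le> 40 * dist u v"
    and K4: "\<And>x. \<bar>x\<bar> \<le> 1/2 \<Longrightarrow> K (of_real x) \<in> \<real>"
    unfolding oc by blast
  obtain G where G: "\<And>w. w \<in> cball 0 5 \<Longrightarrow> norm (G w) \<le> 17 / c"
    "\<And>w. w \<in> cball 0 5 \<Longrightarrow> of_real c * G w + K (G w) = w"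
    "\<And>u w. u \<in> cball 0 (1/2) \<Longrightarrow> of_real c * u + K u = w \<Longrightarrow> w \<in> cball 0 5 \<Longrightarrow> G w = u"
    "continuous_on (cball 0 5) G"
    using perturbed_linear_inverse[OF c K2 K3] by metis
  \<comment> \<open>On the real axis the intermediate value theorem gives a real solution, since
    \<open>c / 2 - 12 \<ge> 3\<close>; uniqueness identifies it with \<open>G (-3)\<close>.\<close>
  define h where "h x = Re (of_real c * of_real x + K (of_real x))" for x
  have Kc: "continuous_on (cball 0 (1/2)) K"
    by (rule lipschitz_on_continuous_on[of 40]) (use K3 in \<open>auto simp: lipschitz_on_def\<close>)
  have "complex_of_real ` {-1/2..1/2} \<subseteq> cball 0 (1/2)" by auto
  moreover have "continuous_on {-1/2..1/2} complex_of_real" by (intro continuous_intros)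
  ultimately have "continuous_on {-1/2..1/2} (\<lambda>x. K (complex_of_real x))"
    using continuous_on_compose2[OF Kc] by blast
  hence "continuous_on {-1/2..1/2} h"
    unfolding h_def by (intro continuous_intros)
  moreover have "h (-1/2) \<le> -3" "-3 \<le> h (1/2)"
  proof -
    have "\<bar>Re (K (of_real x))\<bar> \<le> 12" if "\<bar>x\<bar> \<le> 1/2" for x
      using K2[of "of_real x"] abs_Re_le_cmod[of "K (of_real x)"] that by simp
    from this[of "-1/2"] this[of "1/2"] show "h (-1/2) \<le> -3" "-3 \<le> h (1/2)"
      unfolding h_def plus_complex.sel Re_complex_of_real of_real_mult[symmetric] using c by (simp_all add: abs_le_iff)
  qed
  ultimately obtain x where x: "-1/2 \<le> x" "x \<le> 1/2" "h x = -3"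
    using IVT'[of h "-1/2" "-3" "1/2"] by auto
  hence "of_real c * of_real x + K (of_real x) = -3"
    using K4[of x] by (auto simp: h_def complex_eq_iff complex_is_Real_iff)
  hence "G (-3) = of_real x" using x by (intro G(3)) auto
  hence "inverse_branch j (\<lambda>u. of_real c * u + K u) G c"
    unfolding inverse_branch_def using c K1 G perturbed_linear_bilipschitz[OF c K3] by auto
  thus ?case by blast
qed

end

section \<open>Pulling back rings\<close>

lemma exp_minus_3_less: "exp (-3) < (1/8 :: real)"
proof -
  have "(3/2 :: real) ^ 6 \<le> exp (1/2) ^ 6"
    using exp_ge_add_one_self[of "1/2::real"] by (intro power_mono) auto
  also have "exp (1/2) ^ 6 = exp (3::real)" by (simp flip: exp_of_nat_mult)
  finally show ?thesis by (simp add: exp_minus field_simps power_divide)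
qed

context baker_product
begin

text \<open>The full backward orbit of the escaping chain. Being closed under preimages, it allows
  connected sets to be pulled back without leaving the Fatou set.\<close>

definition absorbed :: "nat \<Rightarrow> complex set" where
  "absorbed J = {z. \<exists>m j. J \<le> j \<and> (f ^^ m) z \<in> annulus j}"

lemma absorbed_backward:
  assumes "f z \<in> absorbed J"
  shows "z \<in> absorbed J"
proof -
  from assms obtain m j where "J \<le> j" "(f ^^ m) (f z) \<in> annulus j" by (auto simp: absorbed_def)
  hence "(f ^^ Suc m) z \<in> annulus j" by (simp add: funpow_swap1)
  thus ?thesis using \<open>J \<le> j\<close> unfolding absorbed_def by blast
qed

lemma annulus_subset_absorbed: "J \<le> j \<Longrightarrow> annulus j \<subseteq> absorbed J"
proof
  fix z assume "J \<le> j" "z \<in> annulus j"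
  hence "J \<le> j \<and> (f ^^ 0) z \<in> annulus j" by simp
  thus "z \<in> absorbed J" unfolding absorbed_def by blast
qed

lemma absorbed_subset_fatou_set:
  assumes "\<And>j. j \<ge> J \<Longrightarrow> f ` annulus j \<subseteq> annulus (Suc j)"
  shows "absorbed J \<subseteq> fatou_set f"
proof
  fix z assume "z \<in> absorbed J"
  then obtain m j where mj: "J \<le> j" "(f ^^ m) z \<in> annulus j" by (auto simp: absorbed_def)
  show "z \<in> fatou_set f"
  proof (rule fatou_set_if_escaping[where A = annulus and R = "\<lambda>j. 5 * r j" and J = J and m = m and j = j])
    show "continuous_on UNIV f" by (rule holomorphic_on_imp_continuous_on[OF holomorphic_f])
    show "open (annulus j)" for j
      unfolding annulus_def by (intro open_Collect_conj open_Collect_less continuous_intros)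
    show "filterlim (\<lambda>j. 5 * r j) at_top sequentially"
      by (rule filterlim_tendsto_pos_mult_at_top[OF tendsto_const _ filterlim_r]) simp
  qed (use assms mj in \<open>auto simp: annulus_def\<close>)
qed

text \<open>In the coordinate \<open>u\<close> with \<open>z = r j * exp u\<close>: a connected part of the absorbed set that joins
  the annulus below \<open>r j\<close> (at \<open>u = -3\<close>) to a ring of radii \<open>\<alpha>, \<beta>\<close> around \<open>q\<close>.\<close>

definition joined_ring :: "nat \<Rightarrow> nat \<Rightarrow> complex set \<Rightarrow> complex \<Rightarrow> real \<Rightarrow> real \<Rightarrow> bool" where
  "joined_ring J j S q \<alpha> \<beta> \<longleftrightarrow> connected S \<and> S \<subseteq> cball 0 5 \<and> -3 \<in> S \<and>
     (\<forall>u\<in>S. of_real (r j) * exp u \<in> absorbed J) \<and>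
     {u. \<alpha> < dist u q \<and> dist u q < \<beta>} \<subseteq> S \<and> ball q \<beta> \<subseteq> cball 0 5 \<and>
     0 < \<alpha> \<and> 0 < \<beta> \<and> \<beta> \<le> 1/2 \<and> Re q \<le> 1/2"

lemma joined_ring_pullback:
  assumes inv: "\<And>i. i \<ge> J \<Longrightarrow> f ` annulus i \<subseteq> annulus (Suc i)"
    and j: "j = Suc i" "i \<ge> J" and gap: "5 * r i < exp (-3) * r j"
    and br: "inverse_branch j H G c"
    and ring: "joined_ring J (Suc j) S q \<alpha> \<beta>"
  shows "\<exists>S'. joined_ring J j S' (G q) (2 * \<alpha> / c) (\<beta> / (2 * c))"
    and "f (of_real (r j) * exp (G q)) = of_real (r (Suc j)) * exp q"
proof -
  have c: "c \<ge> 100"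
    and fH: "\<And>u. u \<in> cball 0 (1/2) \<Longrightarrow> f (of_real (r j) * exp u) = of_real (r (Suc j)) * exp (H u)"
    and H1: "\<And>u v. u \<in> cball 0 (1/2) \<Longrightarrow> v \<in> cball 0 (1/2) \<Longrightarrow> c / 2 * dist u v \<le> dist (H u) (H v)"
    and H2: "\<And>u v. u \<in> cball 0 (1/2) \<Longrightarrow> v \<in> cball 0 (1/2) \<Longrightarrow> dist (H u) (H v) \<le> 2 * c * dist u v"
    and G1: "\<And>w. w \<in> cball 0 5 \<Longrightarrow> norm (G w) \<le> 17 / c"
    and HG: "\<And>w. w \<in> cball 0 5 \<Longrightarrow> H (G w) = w"
    and GH: "\<And>u. u \<in> cball 0 (1/2) \<Longrightarrow> H u \<in> cball 0 5 \<Longrightarrow> G (H u) = u"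
    and Gc: "continuous_on (cball 0 5) G" and Gr: "G (-3) \<in> \<real>"
    using br unfolding inverse_branch_def by auto
  have S: "connected S" "S \<subseteq> cball 0 5" "-3 \<in> S"
    and SA: "\<And>u. u \<in> S \<Longrightarrow> of_real (r (Suc j)) * exp u \<in> absorbed J"
    and SR: "{u. \<alpha> < dist u q \<and> dist u q < \<beta>} \<subseteq> S" and Sb: "ball q \<beta> \<subseteq> cball 0 5"
    and ab: "0 < \<alpha>" "0 < \<beta>" "\<beta> \<le> 1/2"
    using ring unfolding joined_ring_def by auto
  have rj: "r j > 0" "r (Suc j) > 0" using r_pos j by auto
  have "17 / c \<le> 17/100" using c by (intro divide_left_mono) auto
  hence G2: "norm (G w) \<le> 17/100" if "w \<in> cball 0 5" for w using G1[OF that] by linarith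
  have G3: "G w \<in> cball 0 (1/2)" if "w \<in> cball 0 5" for w using G2[OF that] by simp
  have fG: "f (of_real (r j) * exp (G w)) = of_real (r (Suc j)) * exp w" if "w \<in> cball 0 5" for w
    using fH[OF G3[OF that]] HG[OF that] by simp
  have q5: "q \<in> cball 0 5" using Sb ab centre_in_ball[of q \<beta>] by blast
  show "f (of_real (r j) * exp (G q)) = of_real (r (Suc j)) * exp q" by (rule fG[OF q5])
  define g where "g = Re (G (-3))"
  have m3: "-3 \<in> cball (0::complex) 5" by simp
  have g: "G (-3) = of_real g" using Gr by (simp add: g_def)
  have g_abs: "\<bar>g\<bar> \<le> 17/100" using G2[OF m3] by (simp add: g)
  define S' where "S' = G ` S \<union> complex_of_real ` {-3..g}"
  have "connected S'"
    unfolding S'_def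
  proof (rule connected_Un)
    show "connected (G ` S)"
      by (rule connected_continuous_image[OF continuous_on_subset[OF Gc S(2)] S(1)])
    show "connected (complex_of_real ` {-3..g})"
      by (intro connected_continuous_image continuous_intros) auto
    have "G (-3) \<in> G ` S" using S(3) by blast
    moreover have "G (-3) \<in> complex_of_real ` {-3..g}" using g_abs g by auto
    ultimately show "G ` S \<inter> complex_of_real ` {-3..g} \<noteq> {}" by blast
  qed
  moreover have "S' \<subseteq> cball 0 5"
    using G2 S(2) g_abs by (force simp: S'_def)
  moreover have "-3 \<in> S'"
    using g_abs by (auto simp: S'_def image_iff intro!: bexI[of _ "-3"])
  moreover have "of_real (r j) * exp u \<in> absorbed J" if "u \<in> S'" for u
    using that unfolding S'_def
  proof
    assume "u \<in> G ` S"
    then obtain w where w: "w \<in> S" "u = G w" by blast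
    show ?thesis
      unfolding w(2) by (rule absorbed_backward) (use fG[of w] S(2) SA[OF w(1)] w in auto)
  next
    assume "u \<in> complex_of_real ` {-3..g}"
    then obtain x where x: "u = of_real x" "-3 \<le> x" "x \<le> g" by auto
    have re: "of_real (r j) * exp (complex_of_real y) = of_real (r j * exp y)" for y
      by (simp add: exp_of_real)
    \<comment> \<open>The left end of the segment is mapped into \<open>annulus j\<close> and the
      right end to \<open>r (Suc j) * exp (-3)\<close>, which is below \<open>r (Suc j) / 8\<close>.
      By monotonicity the whole segment is mapped into \<open>annulus j\<close>.\<close>
    have "of_real (r j * exp (-3)) \<in> annulus i"
      using gap rj exp_minus_3_less mult_strict_left_mono[OF exp_minus_3_less rj(1)]
      by (simp add: annulus_def j(1) norm_mult mult.commute)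
    hence "f (of_real (r j * exp (-3))) \<in> annulus j"
      using inv[OF j(2)] j(1) by blast
    hence "5 * r j < Re (f (of_real (r j * exp (-3))))"
      using rj norm_f_of_real[of "r j * exp (-3)"] by (simp add: annulus_def)
    also have "\<dots> \<le> Re (f (of_real (r j * exp x)))"
      using x rj by (intro f_of_real_mono) auto
    finally have lo: "5 * r j < Re (f (of_real (r j * exp x)))" .
    have "Re (f (of_real (r j * exp x))) \<le> Re (f (of_real (r j * exp g)))"
      using x rj by (intro f_of_real_mono) auto
    also have "f (of_real (r j * exp g)) = of_real (r (Suc j)) * exp (of_real (-3))"
      using fG[OF m3] unfolding g re by simp
    also have "Re \<dots> = r (Suc j) * exp (-3)" by (simp only: exp_of_real Re_complex_of_real flip: of_real_mult)
    also have "\<dots> < r (Suc j) * (1/8)" by (rule mult_strict_left_mono[OF exp_minus_3_less rj(2)])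
    finally have "f (of_real (r j * exp x)) \<in> annulus j"
      using lo rj norm_f_of_real[of "r j * exp x"] by (simp add: annulus_def)
    hence "f (of_real (r j * exp x)) \<in> absorbed J"
      using annulus_subset_absorbed[of J j] j by auto
    thus ?thesis unfolding x(1) re by (rule absorbed_backward)
  qed
  moreover have small: "\<beta> / (2 * c) \<le> 1/400"
  proof -
    have "\<beta> / (2 * c) \<le> (1/2) / (2 * 100)" using ab c by (intro frac_le) auto
    thus ?thesis by simp
  qed
  moreover have "{u. 2 * \<alpha> / c < dist u (G q) \<and> dist u (G q) < \<beta> / (2 * c)} \<subseteq> S'"
  proof safe
    fix u assume u: "2 * \<alpha> / c < dist u (G q)" "dist u (G q) < \<beta> / (2 * c)"
    have "norm u \<le> dist u (G q) + norm (G q)" using norm_triangle_ineq[of "u - G q" "G q"] by (simp add: dist_norm)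
    hence u2: "u \<in> cball 0 (1/2)" using u(2) small G2[OF q5] by simp
    have "\<alpha> < c / 2 * dist u (G q)" using u(1) c by (simp add: field_simps)
    also have "\<dots> \<le> dist (H u) q" using H1[OF u2 G3[OF q5]] HG[OF q5] by simp
    finally have 1: "\<alpha> < dist (H u) q" .
    have "dist (H u) q \<le> 2 * c * dist u (G q)" using H2[OF u2 G3[OF q5]] HG[OF q5] by simp
    also have "\<dots> < \<beta>" using u(2) c by (simp add: field_simps)
    finally have 2: "dist (H u) q < \<beta>" .
    have "H u \<in> S" using SR 1 2 by blast
    hence "u \<in> G ` S" using GH[OF u2] S(2) by force
    thus "u \<in> S'" by (simp add: S'_def)
  qed
  moreover have "ball (G q) (\<beta> / (2 * c)) \<subseteq> cball 0 5"
  proof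
    fix u assume "u \<in> ball (G q) (\<beta> / (2 * c))"
    hence "norm (u - G q) \<le> 1/400" using small by (simp add: dist_norm norm_minus_commute)
    thus "u \<in> cball 0 5" using norm_triangle_ineq[of "u - G q" "G q"] G2[OF q5] by simp
  qed
  moreover have "Re (G q) \<le> 1/2" using G2[OF q5] abs_Re_le_cmod[of "G q"] by simp
  ultimately have "joined_ring J j S' (G q) (2 * \<alpha> / c) (\<beta> / (2 * c))"
    unfolding joined_ring_def using ab c by auto
  thus "\<exists>S'. joined_ring J j S' (G q) (2 * \<alpha> / c) (\<beta> / (2 * c))" by blast
qed

text \<open>The scales \<open>c\<close> cancel in the quotient of the radii, so exactly a factor 4
  is lost per level. The orbit of the centre is recorded because the final centre must be a preimage
  of 0.\<close>

lemma joined_ring_pullback_iterated: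
  assumes inv: "\<And>i. i \<ge> J \<Longrightarrow> f ` annulus i \<subseteq> annulus (Suc i)"
    and gap: "\<And>i. i \<ge> J \<Longrightarrow> 5 * r i < exp (-3) * r (Suc i)"
    and br: "\<And>j. j \<ge> J \<Longrightarrow> \<exists>H G c. inverse_branch j H G c"
  shows "joined_ring J (j + m) S q \<alpha> \<beta> \<Longrightarrow> J < j \<Longrightarrow>
    \<exists>S' q' \<alpha>' \<beta>'. joined_ring J j S' q' \<alpha>' \<beta>' \<and> \<alpha>' * \<beta> = 4 ^ m * \<alpha> * \<beta>' \<and>
      (f ^^ m) (of_real (r j) * exp q') = of_real (r (j + m)) * exp q"
proof (induction m arbitrary: j)
  case 0
  then show ?case by (intro exI[of _ S] exI[of _ q] exI[of _ \<alpha>] exI[of _ \<beta>]) auto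
next
  case (Suc m)
  have "joined_ring J (Suc j + m) S q \<alpha> \<beta>" "J < Suc j" using Suc.prems by auto
  from Suc.IH[OF this] obtain S1 q1 \<alpha>1 \<beta>1 where 1: "joined_ring J (Suc j) S1 q1 \<alpha>1 \<beta>1"
    "\<alpha>1 * \<beta> = 4 ^ m * \<alpha> * \<beta>1" "(f ^^ m) (of_real (r (Suc j)) * exp q1) = of_real (r (Suc j + m)) * exp q"
    by blast
  obtain i where i: "j = Suc i" "i \<ge> J" using Suc.prems by (cases j) auto
  obtain H G c where b: "inverse_branch j H G c" using br[of j] Suc.prems by auto
  have c: "c \<ge> 100" using b by (simp add: inverse_branch_def)
  have g: "5 * r i < exp (-3) * r j" using gap i by simp
  note pb = joined_ring_pullback[OF inv i g b 1(1)]
  from pb(1) obtain S' where S': "joined_ring J j S' (G q1) (2 * \<alpha>1 / c) (\<beta>1 / (2 * c))" by blast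
  have "2 * \<alpha>1 / c * \<beta> = 4 ^ Suc m * \<alpha> * (\<beta>1 / (2 * c))" using 1(2) c by (simp add: field_simps)
  moreover have "(f ^^ Suc m) (of_real (r j) * exp (G q1)) = of_real (r (j + Suc m)) * exp q"
    using pb(2) 1(3) by (simp add: funpow_swap1)
  ultimately show ?case using S' by blast
qed

end

section \<open>A large ring around each double zero\<close>

lemma one_minus_exp_minus_ge:
  fixes x :: real
  assumes "0 \<le> x" "x \<le> 3"
  shows "x / 4 \<le> 1 - exp (- x)"
proof -
  have "exp (- x) = 1 / exp x" by (simp add: exp_minus divide_inverse)
  also have "\<dots> \<le> 1 / (1 + x)" using assms by (intro divide_left_mono) auto
  finally have "exp (- x) \<le> 1 / (1 + x)" .
  moreover have "x / 4 \<le> x / (1 + x)" using assms by (intro divide_left_mono) auto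
  moreover have "x / (1 + x) = 1 - 1 / (1 + x)" using assms by (simp add: field_simps)
  ultimately show ?thesis by linarith
qed

lemma exp_minus_3_ge: "exp (-3) \<ge> (1/27 :: real)"
proof -
  have "exp (3::real) = exp 1 ^ 3" by (simp flip: exp_of_nat_mult)
  also have "\<dots> \<le> 3 ^ 3" by (intro power_mono exp_le) auto
  finally show ?thesis by (simp add: exp_minus field_simps)
qed

context baker_product
begin

text \<open>The base 3000 exceeds \<open>729 * 4\<close> and 256, the exponential losses in the
  lower bounds for \<open>f\<close> on the connecting segment and on the ring.\<close>

lemma eventually_r_Suc_ge: "\<forall>\<^sub>F n in sequentially. 100000 * 3000 ^ n * r n \<le> r (Suc n)"
  using eventually_r_square[of 100000] eventually_r_ge_power[of 3000] eventually_ge_at_top[of 1]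
proof eventually_elim
  case (elim n)
  have "3000 ^ n * r n \<le> r n * r n" using elim r_pos[of n] by (intro mult_right_mono) auto
  thus ?case using elim(1) by (simp add: power2_eq_square)
qed

lemma eventually_gap: "\<forall>\<^sub>F i in sequentially. 5 * r i < exp (-3) * r (Suc i)"
  using eventually_r_Suc[of 200] eventually_ge_at_top[of 1]
proof eventually_elim
  case (elim i)
  have "1/27 * r (Suc i) \<le> exp (-3) * r (Suc i)"
    using r_pos[of "Suc i"] exp_minus_3_ge by (intro mult_right_mono) auto
  thus ?case using elim r_pos[of i] by linarith
qed

text \<open>Near the double zero \<open>norm (f z)\<close> is comparable to
  \<open>r (Suc n) * norm d ^ 2\<close>, where \<open>d = u - \<i> * pi\<close>. As
  \<open>r (Suc n) / r n\<close> outgrows \<open>256 ^ n\<close>, the value still exceeds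
  \<open>5 * r n\<close> when \<open>norm d > (1/16) ^ n\<close>.\<close>

lemma eventually_joined_ring_at_zero:
  "\<forall>\<^sub>F n in sequentially. f (of_real (r n) * exp (\<i> * pi)) = 0 \<and>
     (\<exists>S. joined_ring J n S (\<i> * pi) ((1/16) ^ n) (1 / (4 * real n)))"
proof -
  have "\<forall>\<^sub>F n in sequentially. 5 * r (n - 1) < exp (-3) * r n"
    by (subst eventually_sequentially_Suc[symmetric]) (use eventually_gap in simp)
  with eventually_f_asymp eventually_r_Suc_ge eventually_ge_at_top[of "J + 2"]
  show ?thesis
  proof eventually_elim
    case (elim n)
    have n: "n \<ge> 2" "J \<le> n" "J \<le> n - 1" and n_Suc: "Suc (n - 1) = n" using elim(3) by auto
    have rn: "r n > 0" "r (Suc n) > 0" using r_pos n by auto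
    have n2: "real n < 2 ^ n" by (rule of_nat_less_two_power)
    define c where "c = 2 * (n - 1)"
    have c: "2 \<le> real c" "real c \<le> 2 * real n" using n by (auto simp: c_def)
    define \<alpha> where "\<alpha> = (1/16 :: real) ^ n"
    have \<alpha>_pos: "\<alpha> > 0" by (simp add: \<alpha>_def)
    have nf: "\<exists>t. 9/10 \<le> t \<and> t \<le> 11/10 \<and> norm (f (of_real (r n) * exp u)) =
        r (Suc n) * exp (real c * Re u) * (norm (1 + exp u) / 2)\<^sup>2 * t" if u: "\<bar>Re u\<bar> \<le> 5" for u
    proof -
      obtain w where w: "norm (w - 1) \<le> 1/10" "f (of_real (r n) * exp u) =
          of_real (r (Suc n)) * exp (of_nat c * u) * ((1 + exp u) / 2)\<^sup>2 * w"
        using elim(1) u unfolding c_def by blast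
      have "norm (f (of_real (r n) * exp u)) = r (Suc n) * exp (real c * Re u) * (norm (1 + exp u) / 2)\<^sup>2 * norm w"
        unfolding w(2) using rn by (simp add: norm_mult norm_power norm_divide)
      moreover have "9/10 \<le> norm w" "norm w \<le> 11/10"
        using w(1) norm_triangle_ineq2[of 1 w] norm_triangle_ineq2[of w 1] by (simp_all add: norm_minus_commute)
      ultimately show ?thesis by blast
    qed
    have hit: "of_real (r n) * exp u \<in> absorbed J"
      if "5 * r n < norm (f (of_real (r n) * exp u))" "norm (f (of_real (r n) * exp u)) < r (Suc n) / 8" for u
    proof (rule absorbed_backward)
      show "f (of_real (r n) * exp u) \<in> absorbed J"
        using that annulus_subset_absorbed[OF n(2)] by (auto simp: annulus_def)
    qed
    have exp_pi: "exp (\<i> * pi + d) = - exp d" for d :: complex by (simp add: exp_add)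
    \<comment> \<open>The path to the ring: up the line \<open>Re u = -3\<close>, which stays in the
      annulus below \<open>r n\<close>, and then along \<open>Im u = pi\<close> towards the zero,
      stopping at distance \<open>1 / (8 * n)\<close> inside the ring.\<close>
    define T1 where "T1 = (\<lambda>y. -3 + \<i> * complex_of_real y) ` {0..pi}"
    define T2 where "T2 = (\<lambda>x. \<i> * pi - complex_of_real x) ` {1 / (8 * real n)..3}"
    define T3 where "T3 = {u. \<alpha> < norm (u - \<i> * pi) \<and> norm (u - \<i> * pi) < 1 / (4 * real n)}"
    have n8: "1 / (8 * real n) \<le> 3" "0 < 1 / (8 * real n)" "1 / (4 * real n) \<le> 1/8" "0 < 1 / (4 * real n)"
    proof -
      have "1 / (8 * real n) \<le> 1 / (8 * 1)" "1 / (4 * real n) \<le> 1 / (4 * 2)" using n by (intro frac_le; simp)+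
      thus "1 / (8 * real n) \<le> 3" "1 / (4 * real n) \<le> 1/8" by simp_all
    qed (use n in simp_all)
    have \<alpha>_less: "\<alpha> < 1 / (8 * real n)"
    proof -
      have "8 * real n < 8 * 2 ^ n" using n2 by simp
      also have "\<dots> \<le> 8 ^ n * 2 ^ n" using n power_increasing[of 1 n "8::real"] by (intro mult_right_mono) auto
      also have "\<dots> = 16 ^ n" by (simp flip: power_mult_distrib)
      finally show ?thesis using n unfolding \<alpha>_def by (simp add: power_divide frac_less2)
    qed
    have "connected (T1 \<union> T2 \<union> T3)"
    proof (intro connected_Un)
      show "connected T1" unfolding T1_def by (intro connected_continuous_image continuous_intros) auto
      show "connected T2" unfolding T2_def by (intro connected_continuous_image continuous_intros) auto
      show "connected T3" unfolding T3_def by (rule connected_annulus) simp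
      have "\<i> * pi - 3 \<in> T1" unfolding T1_def by (rule image_eqI[of _ _ pi]) auto
      moreover have "3 \<in> {1 / (8 * real n)..3}" using n8(1) by (simp only: atLeastAtMost_iff order_refl simp_thms)
      hence "\<i> * pi - 3 \<in> T2" unfolding T2_def by (rule image_eqI[rotated]) simp
      ultimately show "T1 \<inter> T2 \<noteq> {}" by blast
      have "\<i> * pi - of_real (1 / (8 * real n)) \<in> T2"
        unfolding T2_def by (rule imageI) (simp only: atLeastAtMost_iff order_refl n8(1) simp_thms)
      moreover have "\<i> * pi - of_real (1 / (8 * real n)) \<in> T3"
      proof -
        have "norm (\<i> * pi - of_real (1 / (8 * real n)) - \<i> * pi) = 1 / (8 * real n)"
          using n8 by (simp add: norm_divide norm_mult)
        moreover have "1 / (8 * real n) < 1 / (4 * real n)" using n by (simp add: field_simps)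
        ultimately show ?thesis unfolding T3_def using \<alpha>_less by simp
      qed
      ultimately show "(T1 \<union> T2) \<inter> T3 \<noteq> {}" by blast
    qed
    moreover have "T1 \<union> T2 \<union> T3 \<subseteq> cball 0 5"
    proof -
      have rect: "norm u \<le> 5" if "\<bar>Re u\<bar> \<le> 3" "\<bar>Im u\<bar> \<le> 4" for u :: complex
      proof -
        have "(Re u)\<^sup>2 \<le> 3\<^sup>2" "(Im u)\<^sup>2 \<le> 4\<^sup>2" using that by (simp_all only: abs_le_square_iff[symmetric] abs_numeral)
        hence "(norm u)\<^sup>2 \<le> 5\<^sup>2" by (simp add: cmod_power2)
        thus ?thesis by (rule power2_le_imp_le) simp
      qed
      have "u \<in> cball 0 5" if "u \<in> T1 \<union> T2" for u
        using that
      proof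
        assume "u \<in> T1"
        thus ?thesis using pi_less_4 unfolding T1_def by (auto intro!: rect)
      next
        assume "u \<in> T2"
        then obtain x where x: "u = \<i> * pi - of_real x" "1 / (8 * real n) \<le> x" "x \<le> 3" by (auto simp: T2_def)
        have "0 \<le> x" using x(2) n8(2) by linarith
        thus ?thesis using x(1,3) pi_less_4 pi_gt_zero by (auto intro!: rect)
      qed
      moreover have "u \<in> cball 0 5" if "u \<in> T3" for u
      proof -
        have "norm (u - \<i> * pi) \<le> 1/8" using that n8(3) unfolding T3_def mem_Collect_eq by linarith
        thus ?thesis using norm_triangle_ineq[of "u - \<i> * pi" "\<i> * pi"] pi_less_4 pi_gt_zero by (simp add: norm_mult)
      qed
      ultimately show ?thesis by blast
    qed
    moreover have "-3 \<in> T1 \<union> T2 \<union> T3"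
      unfolding T1_def by (intro UnI1 image_eqI[of _ _ 0]) auto
    moreover have "of_real (r n) * exp u \<in> absorbed J" if "u \<in> T1" for u
    proof -
      have "Re u = -3" using that by (auto simp: T1_def)
      hence "norm (of_real (r n) * exp u) = exp (-3) * r n" using rn by (simp add: norm_mult)
      moreover have "exp (-3) * r n < 1/8 * r n" by (rule mult_strict_right_mono[OF exp_minus_3_less rn(1)])
      ultimately have "of_real (r n) * exp u \<in> annulus (n - 1)"
        using elim(4) unfolding annulus_def mem_Collect_eq n_Suc by (intro conjI; linarith)
      thus ?thesis using annulus_subset_absorbed[OF n(3)] by blast
    qed
    moreover have "of_real (r n) * exp u \<in> absorbed J" if uT: "u \<in> T2" for u
    proof -
      obtain x where x: "u = \<i> * pi + of_real (-x)" "1 / (8 * real n) \<le> x" "x \<le> 3"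
        using uT by (auto simp: T2_def)
      have x0: "x \<ge> 0" using x(2) n8 by linarith
      define v where "v = exp (- x)"
      have v: "0 < v" "v \<le> 1" "x / 4 \<le> 1 - v" using one_minus_exp_minus_ge[OF x0 x(3)] x0 by (simp_all add: v_def)
      have "1 + exp u = of_real (1 - v)" unfolding x(1) exp_pi by (simp add: v_def exp_of_real[symmetric])
      hence n1: "norm (1 + exp u) = 1 - v" using v by (metis abs_of_nonneg diff_ge_0_iff_ge norm_of_real)
      have reu: "Re u = - x" by (simp add: x(1))
      then obtain t where t: "9/10 \<le> t" "t \<le> 11/10"
        "norm (f (of_real (r n) * exp u)) = r (Suc n) * exp (real c * (- x)) * ((1 - v) / 2)\<^sup>2 * t"
        using nf[of u] x0 x(3) n1 by auto
      have "exp (real c * (- x)) \<le> exp (2 * (- x))" using c(1) x0 by (simp add: mult_right_mono)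
      also have "\<dots> = v\<^sup>2" by (simp add: v_def flip: exp_double)
      finally have e_up: "exp (real c * (- x)) \<le> v\<^sup>2" .
      \<comment> \<open>As the exponent is at least 2, the value is bounded by a multiple of
        \<open>(v * (1 - v)) ^ 2\<close>, and \<open>v * (1 - v)\<close> is at most
        \<open>1/4\<close>.\<close>
      have "0 \<le> (v - 1/2)\<^sup>2" by simp
      hence "v * (1 - v) \<le> 1/4" by (simp add: power2_eq_square algebra_simps)
      hence vv: "(v * (1 - v))\<^sup>2 \<le> (1/4)\<^sup>2" using v by (intro power_mono) auto
      have "norm (f (of_real (r n) * exp u)) \<le> r (Suc n) * v\<^sup>2 * ((1 - v) / 2)\<^sup>2 * (11/10)"
        unfolding t(3) using t(1,2) e_up rn by (intro mult_mono) auto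
      also have "\<dots> = r (Suc n) * ((v * (1 - v))\<^sup>2 * (11/40))" by (simp add: power_mult_distrib power_divide)
      also have "\<dots> \<le> r (Suc n) * ((1/4)\<^sup>2 * (11/40))" using vv rn by (intro mult_left_mono mult_right_mono) auto
      also have "\<dots> < r (Suc n) / 8" using rn by (simp add: power2_eq_square)
      finally have up: "norm (f (of_real (r n) * exp u)) < r (Suc n) / 8" .
      \<comment> \<open>The lower bound loses \<open>exp (6 * n) \<le> 729 ^ n\<close> from the
        exponential, and \<open>(64 * n) ^ 2 \<le> 4096 * 4 ^ n\<close> from the distance to the
        zero.\<close>
      have "real c * x \<le> (2 * real n) * 3" using c x0 x(3) by (intro mult_mono) auto
      hence "exp (- (real n * 6)) \<le> exp (real c * (- x))" by simp
      moreover have "exp (- (real n * 6)) \<ge> 1 / 729 ^ n"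
      proof -
        have "exp (6::real) = exp 1 ^ 6" by (simp flip: exp_of_nat_mult)
        also have "\<dots> \<le> 3 ^ 6" by (intro power_mono exp_le) auto
        finally have "exp 6 ^ n \<le> (729::real) ^ n" by (intro power_mono) auto
        thus ?thesis by (simp add: exp_minus exp_of_nat_mult inverse_eq_divide frac_le)
      qed
      ultimately have e_lo: "1 / 729 ^ n \<le> exp (real c * (- x))" by linarith
      have "1 / (64 * 2 ^ n) \<le> 1 / (64 * real n)" using n2 n by (intro divide_left_mono) auto
      also have "\<dots> \<le> (1 - v) / 2" using x(2) v(3) by simp
      finally have "(1 / (64 * 2 ^ n))\<^sup>2 \<le> ((1 - v) / 2)\<^sup>2" by (intro power_mono) auto
      also have "(1 / (64 * 2 ^ n))\<^sup>2 = 1 / (4096 * (4::real) ^ n)"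
        using power_mult_distrib[of "2::real" 2 n] by (simp add: power2_eq_square power_divide)
      finally have v_lo: "1 / (4096 * 4 ^ n) \<le> ((1 - v) / 2)\<^sup>2" .
      have "5 * r n < 100000 * r n * (9/10) / 4096" using rn by simp
      also have "\<dots> \<le> 100000 * 3000 ^ n * r n * (1 / 2916 ^ n) * (9/10) / 4096"
        using rn power_mono[of 2916 "3000::real" n] by (simp add: field_simps)
      also have "\<dots> = (100000 * 3000 ^ n * r n) * (1 / 729 ^ n) * (1 / (4096 * 4 ^ n)) * (9/10)"
        using power_mult_distrib[of "729::real" 4 n] by (simp add: mult_ac)
      also have "\<dots> \<le> norm (f (of_real (r n) * exp u))"
        unfolding t(3) using t(1) e_lo v_lo rn elim(2) by (intro mult_mono) auto
      finally show ?thesis using up by (intro hit)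
    qed
    moreover have "of_real (r n) * exp u \<in> absorbed J" if "u \<in> T3" for u
    proof -
      define d where "d = u - \<i> * pi"
      have u: "u = \<i> * pi + d" by (simp add: d_def)
      have d: "\<alpha> < norm d" "norm d < 1 / (4 * real n)" using that by (auto simp: T3_def d_def)
      have d8: "norm d \<le> 1/8" using d n8 by linarith
      have n1: "1 / 2 * norm d \<le> norm (1 + exp u)" "norm (1 + exp u) \<le> 3 / 2 * norm d"
        using norm_exp_bounds[of d] d8 unfolding u exp_pi by (simp_all add: norm_minus_commute)
      have reu: "Re u = Re d" by (simp add: u)
      have red: "\<bar>Re d\<bar> \<le> 1 / (4 * real n)" using abs_Re_le_cmod[of d] d by linarith
      have re5: "\<bar>Re u\<bar> \<le> 5" using red reu n8(3) by linarith
      obtain t where t: "9/10 \<le> t" "t \<le> 11/10"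
        "norm (f (of_real (r n) * exp u)) = r (Suc n) * exp (real c * Re d) * (norm (1 + exp u) / 2)\<^sup>2 * t"
        using nf[OF re5] reu by auto
      \<comment> \<open>The outer radius \<open>1 / (4 * n)\<close> is chosen so that the
        exponential factor stays between \<open>1/2\<close> and 2 on the ring.\<close>
      have "\<bar>real c * Re d\<bar> \<le> (2 * real n) * (1 / (4 * real n))"
        unfolding abs_mult using c red by (intro mult_mono) auto
      also have "\<dots> = 1/2" using n by simp
      finally have cd: "- (1/2) \<le> real c * Re d" "real c * Re d \<le> 1/2" by auto
      have "exp (1/2) \<le> (2::real)" using real_exp_bound_lemma[of "1/2"] by simp
      hence e_up: "exp (real c * Re d) \<le> 2" using cd(2) exp_le_cancel_iff[of "real c * Re d" "1/2"] by linarith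
      have e_lo: "1/2 \<le> exp (real c * Re d)"
        using exp_ge_add_one_self[of "real c * Re d"] cd(1) by linarith
      have "norm (1 + exp u) / 2 \<le> 3/32" using n1(2) d8 by simp
      hence "norm (f (of_real (r n) * exp u)) \<le> r (Suc n) * 2 * (3/32)\<^sup>2 * (11/10)"
        unfolding t(3) using t(1,2) e_up rn by (intro mult_mono power_mono) auto
      also have "\<dots> < r (Suc n) / 8" using rn by (simp add: power2_eq_square)
      finally have up: "norm (f (of_real (r n) * exp u)) < r (Suc n) / 8" .
      have "\<alpha> / 4 \<le> norm (1 + exp u) / 2" using n1(1) d(1) by simp
      hence a_lo: "(\<alpha> / 4)\<^sup>2 \<le> (norm (1 + exp u) / 2)\<^sup>2" using \<alpha>_pos by (intro power_mono) auto
      have a2: "\<alpha>\<^sup>2 = 1 / 256 ^ n"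
        using power_mult_distrib[of "1/16::real" "1/16" n] by (simp add: \<alpha>_def power2_eq_square power_divide)
      have "5 * r n < 100000 * r n * (1/2) * (1/16) * (9/10)" using rn by simp
      also have "\<dots> \<le> (100000 * 3000 ^ n * r n) * (1/2) * (1/16 * (1 / 256 ^ n)) * (9/10)"
        using rn power_mono[of 256 "3000::real" n] by (simp add: field_simps)
      also have "1/16 * (1 / 256 ^ n) = (\<alpha> / 4)\<^sup>2" by (simp add: a2 power_divide)
      also have "(100000 * 3000 ^ n * r n) * (1/2) * (\<alpha> / 4)\<^sup>2 * (9/10) \<le> norm (f (of_real (r n) * exp u))"
        unfolding t(3) using t(1) e_lo a_lo rn elim(2) by (intro mult_mono) auto
      finally show ?thesis using up by (intro hit)
    qed
    moreover have "{u. \<alpha> < dist u (\<i> * pi) \<and> dist u (\<i> * pi) < 1 / (4 * real n)} \<subseteq> T1 \<union> T2 \<union> T3"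
      by (auto simp: T3_def dist_norm)
    moreover have "ball (\<i> * pi) (1 / (4 * real n)) \<subseteq> cball 0 5"
    proof
      fix u assume "u \<in> ball (\<i> * pi) (1 / (4 * real n))"
      hence "norm (u - \<i> * pi) < 1 / (4 * real n)" by (simp add: dist_norm norm_minus_commute)
      hence "norm (u - \<i> * pi) \<le> 1/8" using n8(3) by linarith
      thus "u \<in> cball 0 5"
        using norm_triangle_ineq[of "u - \<i> * pi" "\<i> * pi"] pi_less_4 pi_gt_zero by (simp add: norm_mult)
    qed
    ultimately have "joined_ring J n (T1 \<union> T2 \<union> T3) (\<i> * pi) \<alpha> (1 / (4 * real n))"
      unfolding joined_ring_def using \<alpha>_pos n by auto
    moreover have "f (of_real (r n) * exp (\<i> * pi)) = 0"
      using nf[of "\<i> * pi"] exp_pi[of 0] by auto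
    ultimately show ?case unfolding \<alpha>_def by blast
  qed
qed

end

section \<open>The frontier of the wandering domain\<close>

lemma components_eq_if_common_point:
  assumes "C \<in> components S" "D \<in> components S" "z \<in> C" "z \<in> D"
  shows "C = D"
  using assms components_nonoverlap[of C S D] by blast

context baker_product
begin

text \<open>The image of the ring under the exponential is not round. With
  \<open>v = exp d - 1\<close>, the bounds \<open>norm d \<le> 2 * norm v\<close> and
  \<open>norm v \<le> 3/2 * norm d\<close> show that shrinking by a factor 2 on each side
  suffices.\<close>

lemma joined_ring_round_annulus:
  assumes "joined_ring J j S q \<alpha> \<beta>" "r j > 0"
  defines "a \<equiv> of_real (r j) * exp q"
  shows "{z. 2 * \<alpha> * norm a < dist z a \<and> dist z a < \<beta> / 2 * norm a} \<subseteq> (\<lambda>u. of_real (r j) * exp u) ` S"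
proof safe
  fix z assume z: "2 * \<alpha> * norm a < dist z a" "dist z a < \<beta> / 2 * norm a"
  have R: "{u. \<alpha> < dist u q \<and> dist u q < \<beta>} \<subseteq> S" and \<alpha>\<beta>: "0 < \<alpha>" "0 < \<beta>" "\<beta> \<le> 1/2"
    using assms(1) unfolding joined_ring_def by auto
  have a: "a \<noteq> 0" using assms(2) by (simp add: a_def)
  define v where "v = (z - a) / a"
  have nv: "norm v = dist z a / norm a" by (simp add: v_def norm_divide dist_norm)
  have v: "2 * \<alpha> < norm v" "norm v < \<beta> / 2" using z a by (simp_all add: nv field_simps)
  have v1: "1 + v = z / a" using a by (simp add: v_def field_simps)
  have "1 + v \<noteq> 0"
  proof
    assume "1 + v = 0"
    hence "v = -1" by (simp add: add_eq_0_iff)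
    thus False using v(2) \<alpha>\<beta> by simp
  qed
  define d where "d = Ln (1 + v)"
  have ed: "exp d = 1 + v" using \<open>1 + v \<noteq> 0\<close> by (simp add: d_def)
  have "norm d \<le> 2 * norm v" unfolding d_def by (rule norm_Ln_le) (use v \<alpha>\<beta> in simp)
  hence d1: "norm d < \<beta>" using v by simp
  have "norm (exp d - 1) \<le> 3/2 * norm d" using d1 \<alpha>\<beta> by (intro norm_exp_bounds) auto
  hence "norm v \<le> 3/2 * norm d" by (simp add: ed)
  hence d2: "\<alpha> < norm d" using v \<alpha>\<beta> by linarith
  have "q + d \<in> S" using R d1 d2 by (auto simp: dist_norm)
  moreover have "z = of_real (r j) * exp (q + d)"
    using v1 a by (simp add: exp_add ed a_def field_simps)
  ultimately show "z \<in> (\<lambda>u. of_real (r j) * exp u) ` S" by blast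
qed

text \<open>For fixed \<open>k\<close>, rings pulled back from ever higher levels \<open>n\<close>
  to level \<open>Suc k\<close> all lie in \<open>U\<close>, as they are joined within the Fatou set
  to one base point \<open>b\<close>. Their ratios \<open>\<alpha> / \<beta>\<close> tend to
  0.\<close>

lemma frontier_not_uniformly_perfect:
  "\<forall>\<^sub>F k in sequentially. \<forall>U.
     wandering_domain f U \<and> multiply_connected U \<and>
     {z. (r k)\<^sup>2 < cmod z \<and> cmod z < (real k + 1) / (real k + 2) * r (k + 1)} \<subseteq> U
     \<longrightarrow> \<not> uniformly_perfect (frontier U)"
proof -
  have "\<forall>\<^sub>F k in sequentially. f ` annulus k \<subseteq> annulus (Suc k) \<and> (\<exists>H G c. inverse_branch k H G c) \<and>
      5 * r k < exp (-3) * r (Suc k)"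
    using eventually_f_annulus eventually_inverse_branch eventually_gap by eventually_elim blast
  then obtain J where J0: "\<forall>k\<ge>J. f ` annulus k \<subseteq> annulus (Suc k) \<and> (\<exists>H G c. inverse_branch k H G c) \<and>
      5 * r k < exp (-3) * r (Suc k)"
    unfolding eventually_sequentially by blast
  hence J: "\<And>k. k \<ge> J \<Longrightarrow> f ` annulus k \<subseteq> annulus (Suc k)"
    "\<And>k. k \<ge> J \<Longrightarrow> \<exists>H G c. inverse_branch k H G c"
    "\<And>k. k \<ge> J \<Longrightarrow> 5 * r k < exp (-3) * r (Suc k)"
    by blast+
  note absorbed_fatou = absorbed_subset_fatou_set[of J, OF J(1)]
  \<comment> \<open>Since \<open>exp 3 \<le> 27\<close>, this puts the base point
    \<open>r (Suc k) * exp (-3)\<close> above Baker's inner radius \<open>r k ^ 2\<close>.\<close>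
  have "\<forall>\<^sub>F k in sequentially. 28 * (r k)\<^sup>2 \<le> r (Suc k)" by (rule eventually_r_square)
  thus ?thesis using eventually_ge_at_top[of J] eventually_ge_at_top[of 1]
  proof eventually_elim
    case (elim k)
    have rk: "r k > 0" "r (Suc k) > 0" using r_pos elim by auto
    define b where "b = complex_of_real (r (Suc k) * exp (-3))"
    have nb: "norm b = exp (-3) * r (Suc k)" using rk by (simp add: b_def mult.commute norm_mult)
    have e3: "exp (-3) * r (Suc k) < 1/8 * r (Suc k)" by (rule mult_strict_right_mono[OF exp_minus_3_less rk(2)])
    have b_annulus: "b \<in> annulus k" using J(3)[OF elim(2)] e3 nb by (simp add: annulus_def)
    have b_Baker: "b \<in> {z. (r k)\<^sup>2 < cmod z \<and> cmod z < (real k + 1) / (real k + 2) * r (k + 1)}"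
    proof -
      have "1/27 * r (Suc k) \<le> exp (-3) * r (Suc k)" using rk exp_minus_3_ge by (intro mult_right_mono) auto
      moreover have "(r k)\<^sup>2 > 0" using rk by simp
      ultimately have "(r k)\<^sup>2 < exp (-3) * r (Suc k)" using elim(1) by linarith
      moreover
      have "1/8 * r (Suc k) \<le> (real k + 1) / (real k + 2) * r (Suc k)"
        using rk by (intro mult_right_mono) (auto simp: field_simps)
      ultimately show ?thesis using e3 unfolding mem_Collect_eq nb Suc_eq_plus1[symmetric] by (intro conjI; linarith)
    qed
    show ?case
    proof (intro allI impI, elim conjE)
      fix U assume U: "wandering_domain f U" "multiply_connected U"
        and BU: "{z. (r k)\<^sup>2 < cmod z \<and> cmod z < (real k + 1) / (real k + 2) * r (k + 1)} \<subseteq> U"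
      have "open U" using U(2) by (simp add: multiply_connected_def)
      have bU: "b \<in> U" using BU b_Baker by blast
      have compU: "U \<in> components (fatou_set f)" using U(1) by (simp add: wandering_domain_def fatou_component_def)
      obtain V where V: "\<And>i. V i \<in> components (fatou_set f)" "\<And>i. (f ^^ i) ` U \<subseteq> V i" "inj V"
        using U(1) unfolding wandering_domain_def fatou_component_def by blast
      have V_eq: "i = i'" if "z \<in> V i" "z \<in> V i'" for i i' z
        using components_eq_if_common_point[OF V(1) V(1) that] V(3) by (simp add: inj_eq)
      \<comment> \<open>The components \<open>V i\<close> are pairwise different, hence disjoint, so
        0 lies in at most one of them.\<close>
      have "\<forall>\<^sub>F i in sequentially. 0 \<notin> V i"
      proof (cases "\<exists>i. 0 \<in> V i")
        case True
        then obtain i0 where "0 \<in> V i0" by blast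
        hence gt: "0 \<notin> V i" if "i0 < i" for i using V_eq[of 0 i i0] that by auto
        show ?thesis by (rule eventually_mono[OF eventually_gt_at_top[of i0] gt])
      qed auto
      then obtain N where N: "\<And>i. i \<ge> N \<Longrightarrow> 0 \<notin> V i" by (auto simp: eventually_sequentially)
      \<comment> \<open>The point outside \<open>U\<close> that the ring need not enclose:
        \<open>f b\<close> lies in \<open>V 1\<close>, whereas \<open>U\<close> is contained in
        \<open>V 0\<close>.\<close>
      have fb: "f b \<notin> U"
      proof
        assume "f b \<in> U"
        hence "(f ^^ 0) (f b) \<in> V 0" using V(2) by blast
        moreover have "(f ^^ 1) b \<in> V 1" using V(2) bU by blast
        ultimately show False using V_eq[of "f b" 0 1] by simp
      qed
      have fb_large: "5 * r (Suc k) < norm (f b)"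
        using J(1)[OF elim(2)] b_annulus by (auto simp: annulus_def)
      show "\<not> uniformly_perfect (frontier U)"
      proof (rule not_uniformly_perfect_frontierI[OF \<open>open U\<close>])
        fix \<epsilon> :: real assume "\<epsilon> > 0"
        \<comment> \<open>The quotient to be made small is
          \<open>4 * \<alpha> / \<beta> = 16 * n * 4 ^ m * (1/16) ^ n\<close>, and
          \<open>m \<le> n\<close>.\<close>
        have "(\<lambda>n. 64 * real n * (1/4) ^ n) \<longlonglongrightarrow> 0" by real_asymp
        hence "\<forall>\<^sub>F n in sequentially. 64 * real n * (1/4) ^ n < \<epsilon>"
          using \<open>\<epsilon> > 0\<close> by (rule order_tendstoD)
        hence "\<forall>\<^sub>F n in sequentially. n \<ge> Suc k + N \<and> 64 * real n * (1/4) ^ n < \<epsilon> \<and> f (of_real (r n) * exp (\<i> * pi)) = 0 \<and>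
             (\<exists>S. joined_ring J n S (\<i> * pi) ((1/16) ^ n) (1 / (4 * real n)))"
          using eventually_joined_ring_at_zero[of J] eventually_ge_at_top[of "Suc k + N"]
          by eventually_elim auto
        from eventually_happens'[OF sequentially_bot this]
        obtain n S0 where n: "n \<ge> Suc k + N" and n_small: "64 * real n * (1/4) ^ n < \<epsilon>"
          and zero: "f (of_real (r n) * exp (\<i> * pi)) = 0"
          and S0n: "joined_ring J n S0 (\<i> * pi) ((1/16) ^ n) (1 / (4 * real n))"
          by blast
        define m where "m = n - Suc k"
        have m: "n = Suc k + m" "m \<ge> N" using n by (auto simp: m_def)
        have S0: "joined_ring J (Suc k + m) S0 (\<i> * pi) ((1/16) ^ n) (1 / (4 * real n))"
          using S0n by (simp only: m(1)[symmetric])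
        have "J < Suc k" using elim by simp
        obtain S q \<alpha> \<beta> where ring: "joined_ring J (Suc k) S q \<alpha> \<beta>"
          and ratio: "\<alpha> * (1 / (4 * real n)) = 4 ^ m * (1/16) ^ n * \<beta>"
          and orbit: "(f ^^ m) (of_real (r (Suc k)) * exp q) = of_real (r (Suc k + m)) * exp (\<i> * pi)"
          using joined_ring_pullback_iterated[OF J(1,3,2) S0 \<open>J < Suc k\<close>] by blast
        define a where "a = of_real (r (Suc k)) * exp q"
        define Z where "Z = (\<lambda>u. of_real (r (Suc k)) * exp u) ` S"
        have S: "connected S" "-3 \<in> S" "Re q \<le> 1/2" "0 < \<alpha>" "0 < \<beta>" "\<beta> \<le> 1/2"
          and SJ: "Z \<subseteq> absorbed J"
          using ring unfolding joined_ring_def Z_def by auto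
        have "connected Z"
          unfolding Z_def by (intro connected_continuous_image continuous_intros S(1))
        moreover have "Z \<subseteq> fatou_set f" using SJ absorbed_fatou by blast
        moreover have "b \<in> Z"
        proof -
          have "b = of_real (r (Suc k)) * exp (-3)" unfolding b_def of_real_mult exp_of_real[symmetric] by simp
          thus ?thesis unfolding Z_def using S(2) by blast
        qed
        ultimately have "Z \<subseteq> U" using components_maximal[OF compU] bU by blast
        with joined_ring_round_annulus[OF ring rk(2), folded a_def Z_def]
        have sub: "{z. 2 * \<alpha> * norm a < dist z a \<and> dist z a < \<beta> / 2 * norm a} \<subseteq> U" by blast
        have a_pos: "norm a > 0" using rk by (simp add: a_def)
        \<comment> \<open>After \<open>m\<close> steps the centre reaches the zero
          \<open>- r n\<close>, and one more step leads to 0; \<open>m \<ge> N\<close> excludes 0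
          from the component of that index.\<close>
        have "(f ^^ Suc m) a = 0" using orbit zero by (simp add: a_def m(1))
        moreover have "0 \<notin> V (Suc m)" using N m(2) by simp
        ultimately have "a \<notin> U" using V(2)[of "Suc m"] by (metis image_subset_iff)
        have n0: "real n > 0" using m(1) by simp
        have "4 * \<alpha> = 16 * real n * (4 ^ m * (1/16) ^ n) * \<beta>"
        proof -
          have "4 * \<alpha> = 16 * real n * (\<alpha> * (1 / (4 * real n)))" using n0 by simp
          thus ?thesis unfolding ratio by (simp only: mult.assoc)
        qed
        also have "\<dots> \<le> 16 * real n * (4 ^ n * (1/16) ^ n) * \<beta>"
          using S(5) m(1) by (intro mult_right_mono mult_left_mono power_increasing) auto
        also have "4 ^ n * (1/16) ^ n = (1/4 :: real) ^ n" unfolding power_mult_distrib[symmetric] by simp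
        also have "16 * real n * (1/4) ^ n * \<beta> \<le> 64 * real n * (1/4) ^ n * \<beta>"
          using S(5) by (intro mult_right_mono) auto
        also have "\<dots> < \<epsilon> * \<beta>" using n_small S(5) by (intro mult_strict_right_mono)
        finally have "2 * \<alpha> * norm a < \<epsilon> * (\<beta> / 2 * norm a)"
          using a_pos by simp
        \<comment> \<open>The ring has outer radius at most
          \<open>norm a \<le> 2 * r (Suc k)\<close>, whereas \<open>f b\<close> has norm above
          \<open>5 * r (Suc k)\<close>.\<close>
        moreover have "\<beta> / 2 * norm a \<le> dist (f b) a"
        proof -
          have "exp (Re q) \<le> exp (1/2)" using S(3) by simp
          also have "\<dots> \<le> 2" using real_exp_bound_lemma[of "1/2"] by simp
          finally have "norm a \<le> 2 * r (Suc k)" using rk by (simp add: a_def norm_mult)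
          moreover have "\<beta> / 2 * norm a \<le> 1 * norm a" using S(6) by (intro mult_right_mono) auto
          moreover have "norm (f b) - norm a \<le> dist (f b) a" by (simp add: dist_norm norm_triangle_ineq2)
          ultimately show ?thesis using fb_large rk by linarith
        qed
        moreover have "0 < 2 * \<alpha> * norm a" using S(4) a_pos by simp
        ultimately show "\<exists>a0 \<alpha> \<beta> y. 0 < \<alpha> \<and> \<alpha> < \<epsilon> * \<beta> \<and>
           {z. \<alpha> < dist z a0 \<and> dist z a0 < \<beta>} \<subseteq> U \<and> a0 \<notin> U \<and> y \<notin> U \<and> \<beta> \<le> dist y a0"
          using sub \<open>a \<notin> U\<close> fb by blast
      qed
    qed
  qed
qed

end

theorem mainTheorem5:
  fixes C :: real and r :: "nat \<Rightarrow> real" and k0 :: nat and f :: "complex \<Rightarrow> complex"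
  assumes "0 < C" and "C < 1 / (4 * (exp 1)\<^sup>2)"
    and "r 1 > 1"
    and "k0 \<ge> 1" and "2 ^ (k0 - 1) * C > 2 * r 1"
    and "\<And>k. 1 \<le> k \<Longrightarrow> k < k0 \<Longrightarrow> r (k + 1) \<ge> 2 * r k"
    and "\<And>k. k \<ge> k0 \<Longrightarrow> r (k + 1) = C\<^sup>2 * (\<Prod>j = 1..k. (1 + r k / r j)\<^sup>2)"
    and "\<And>z. f z = (complex_of_real C)\<^sup>2 * (\<Prod>k. (1 + z / complex_of_real (r (k + 1)))\<^sup>2)"
  shows "\<forall>\<^sub>F k in sequentially. \<forall>U.
           wandering_domain f U \<and> multiply_connected U \<and>
           {z. (r k)\<^sup>2 < cmod z \<and> cmod z < (real k + 1) / (real k + 2) * r (k + 1)} \<subseteq> U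
           \<longrightarrow> \<not> uniformly_perfect (frontier U)"
proof -
  interpret baker_product C r k0 f
    using assms by unfold_locales
  show ?thesis by (rule frontier_not_uniformly_perfect)
qed

end
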